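(* Let $p>2$ and let $u$ be an entire solution of the half-space problem $$u_t-\Delta u=|\nabla u|^p\ \text{ in } \mathbb{R}^n_+\times\mathbb{R},\qquad u=0 \text{ on } \partial\mathbb{R}^n_+\times\mathbb{R}.$$ Then $u$ is independent of $t$ and depends only on the variable $x_n$.
   Context: $\mathbb{R}^n_+:=\{x=(x_1,\dots,x_n)\in\mathbb{R}^n: x_n>0\}$. For an interval $I$, a solution of the problem $u_t-\Delta u=|\nabla u|^p$ in $Q:=\mathbb{R}^n_+\times I$, $u=0$ on $\partial\mathbb{R}^n_+\times I$, is a function $u\in C^{2,1}(Q)\cap C(\overline Q)$ satisfying the PDE pointwise in $Q$ and the boundary condition pointwise (no growth restriction at infinity and no $C^1$ regularity up to $x_n=0$ is required). It is called ancient if $I=(-\infty,0)$ and entire if $I=\mathbb{R}$. *)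

theory Defs
  imports "HOL-Analysis.Analysis"
begin

definition half_space :: "'n::finite \<Rightarrow> (real^'n) set" where
  "half_space k = {x. x $ k > 0}"

text \<open>u is a solution of u_t - Delta u = |grad u|^p in Q = half_space k \<times> I,
  u = 0 on the boundary x $ k = 0, with u in C^{2,1}(Q) \<inter> C(closure Q).
  Du = spatial gradient, D2u = spatial Hessian (row i = gradient of the i-th
  component of Du), ut = time derivative; all jointly continuous on Q.
  I is assumed open here (used with I = UNIV).\<close>

definition is_solution ::
  "real \<Rightarrow> 'n::finite \<Rightarrow> real set \<Rightarrow> (real^'n \<Rightarrow> real \<Rightarrow> real) \<Rightarrow> bool" where
  "is_solution p k I u \<longleftrightarrow>
    (\<exists>Du D2u ut.
      (\<forall>x\<in>half_space k. \<forall>t\<in>I.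
          ((\<lambda>y. u y t) has_derivative (\<lambda>h. Du x t \<bullet> h)) (at x)
        \<and> (\<forall>i. ((\<lambda>y. Du y t $ i) has_derivative (\<lambda>h. D2u x t $ i \<bullet> h)) (at x))
        \<and> ((\<lambda>s. u x s) has_real_derivative ut x t) (at t)
        \<and> ut x t - (\<Sum>i\<in>UNIV. D2u x t $ i $ i) = norm (Du x t) powr p)
    \<and> continuous_on (half_space k \<times> I) (\<lambda>(x, t). Du x t)
    \<and> continuous_on (half_space k \<times> I) (\<lambda>(x, t). D2u x t)
    \<and> continuous_on (half_space k \<times> I) (\<lambda>(x, t). ut x t))
    \<and> continuous_on (closure (half_space k \<times> I)) (\<lambda>(x, t). u x t)
    \<and> (\<forall>x t. x $ k = 0 \<longrightarrow> t \<in> closure I \<longrightarrow> u x t = 0)"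

definition entire_solution ::
  "real \<Rightarrow> 'n::finite \<Rightarrow> (real^'n \<Rightarrow> real \<Rightarrow> real) \<Rightarrow> bool" where
  "entire_solution p k u \<longleftrightarrow> is_solution p k UNIV u"

end

theory Submission
  imports Defs
begin

text \<open>A barrier that is infinite on the lateral boundary of a paraboloid gives, without any
  growth assumption, \<open>u (x, s + R\<^sup>2) \<ge> u (y, s) - C R\<^sup>\<alpha>\<close> with \<open>\<alpha> = (p - 2) / (p - 1)\<close>.
  Chaining this inequality towards the boundary, where \<open>u = 0\<close>, forwards and backwards in time
  gives \<open>\<bar>u\<bar> \<le> C x\<^sub>k\<^sup>\<alpha>\<close>; the forward chain is where the solution has to be entire rather than ancient.
  A doubling-of-variables form of Bernstein's method, which needs no third derivatives, turns this
  into \<open>\<bar>\<nabla>u\<bar> \<le> C x\<^sub>k\<^bsup>\<alpha> - 1\<^esup>\<close>. As \<open>0 < \<alpha> < 1\<close>, the difference of \<open>u\<close> and a tangential or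
  time translate of \<open>u\<close> tends to \<open>0\<close> both at the boundary and as \<open>x\<^sub>k \<rightarrow> \<infinity>\<close>, uniformly in the other
  variables; on the remaining strip it solves a linear equation with bounded drift, and the maximum
  principle shows that it vanishes.\<close>

section \<open>Pointwise gradient and Laplacian\<close>

text \<open>The solution is only C^{2,1} inside and merely continuous up to the boundary, so the
  equation cannot be differentiated and no boundary gradient is at hand. Every estimate is therefore
  read off at an extremum of an auxiliary function, where a gradient and a Laplacian at one point
  suffice. \<open>grad_lap\<close> records just this pair: first derivatives near the point, second
  derivatives at the point itself, and only the trace of the Hessian. The exponent \<alpha> is the
  one for which c^(-\<alpha>) u(a + c x, b + c^2 t) solves the same equation, so local estimates are
  needed at unit scale only. The gradient may blow up at the boundary, which makes the drift in the
  linear equation for an increment unbounded there. For this reason a layer of thickness \<epsilon>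
  is cut off: the growth bound makes the increment small on its edge, and above it the drift is
  bounded. The tolerance, and \<epsilon> with it, is arbitrary.\<close>

definition grad_lap :: "(real^'n \<Rightarrow> real) \<Rightarrow> real^'n \<Rightarrow> real^'n \<Rightarrow> real \<Rightarrow> bool" where
  "grad_lap f x g h \<longleftrightarrow> (\<exists>D H.
      (\<forall>\<^sub>F y in nhds x. (f has_derivative (\<lambda>v. D y \<bullet> v)) (at y)) \<and> D x = g
    \<and> (\<forall>i. ((\<lambda>y. D y $ i) has_derivative (\<lambda>v. H i \<bullet> v)) (at x))
    \<and> h = (\<Sum>i\<in>UNIV. H i $ i))"

lemma grad_lapI:
  assumes "\<forall>\<^sub>F y in nhds x. (f has_derivative (\<lambda>v. D y \<bullet> v)) (at y)" "D x = g"
    "\<And>i. ((\<lambda>y. D y $ i) has_derivative (\<lambda>v. H i \<bullet> v)) (at x)"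
    "h = (\<Sum>i\<in>UNIV. H i $ i)"
  shows "grad_lap f x g h"
  unfolding grad_lap_def using assms by blast

lemma grad_lap_has_derivative:
  assumes "grad_lap f x g h"
  shows "(f has_derivative (\<lambda>v. g \<bullet> v)) (at x)"
  using assms unfolding grad_lap_def by (auto dest: eventually_nhds_x_imp_x)

lemma grad_lap_const: "grad_lap (\<lambda>x. c) x 0 0"
  by (rule grad_lapI[where D="\<lambda>_. 0" and H="\<lambda>_. 0"]) auto

lemma grad_lap_component: "grad_lap (\<lambda>x. x $ k) x (axis k 1) 0"
proof (rule grad_lapI[where D="\<lambda>_. axis k 1" and H="\<lambda>_. 0"])
  show "\<forall>\<^sub>F y in nhds x. ((\<lambda>x. x $ k) has_derivative (\<bullet>) (axis k 1)) (at y)"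
    by (intro always_eventually allI 
        has_derivative_eq_rhs[OF bounded_linear_imp_has_derivative[OF bounded_linear_vec_nth]])
      (simp add: fun_eq_iff inner_axis')
qed auto

lemma grad_lap_add:
  assumes "grad_lap f1 x g1 h1" "grad_lap f2 x g2 h2"
  shows "grad_lap (\<lambda>x. f1 x + f2 x) x (g1 + g2) (h1 + h2)"
proof -
  obtain D1 H1 where 1: "\<forall>\<^sub>F y in nhds x. (f1 has_derivative (\<lambda>v. D1 y \<bullet> v)) (at y)" "D1 x = g1"
    "\<And>i. ((\<lambda>y. D1 y $ i) has_derivative (\<lambda>v. H1 i \<bullet> v)) (at x)" "h1 = (\<Sum>i\<in>UNIV. H1 i $ i)"
    using assms(1) unfolding grad_lap_def by blast
  obtain D2 H2 where 2: "\<forall>\<^sub>F y in nhds x. (f2 has_derivative (\<lambda>v. D2 y \<bullet> v)) (at y)" "D2 x = g2"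
    "\<And>i. ((\<lambda>y. D2 y $ i) has_derivative (\<lambda>v. H2 i \<bullet> v)) (at x)" "h2 = (\<Sum>i\<in>UNIV. H2 i $ i)"
    using assms(2) unfolding grad_lap_def by blast
  show ?thesis
  proof (rule grad_lapI[where D="\<lambda>y. D1 y + D2 y" and H="\<lambda>i. H1 i + H2 i"])
    show "\<forall>\<^sub>F y in nhds x. ((\<lambda>x. f1 x + f2 x) has_derivative (\<bullet>) (D1 y + D2 y)) (at y)"
      using 1(1) 2(1)
      by eventually_elim
        (rule has_derivative_eq_rhs[OF has_derivative_add], auto simp: fun_eq_iff inner_add_left)
    show "((\<lambda>y. (D1 y + D2 y) $ i) has_derivative (\<bullet>) (H1 i + H2 i)) (at x)" for i
      using has_derivative_add[OF 1(3)[of i] 2(3)[of i]]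
      by (auto simp: fun_eq_iff inner_add_left elim!: has_derivative_eq_rhs)
  qed (use 1 2 in \<open>auto simp: sum.distrib\<close>)
qed

lemma grad_lap_compose:
  assumes "grad_lap f x g h"
    and \<phi>1: "\<forall>\<^sub>F s in nhds (f x). (\<phi> has_real_derivative \<phi>' s) (at s)"
    and \<phi>2: "(\<phi>' has_real_derivative c) (at (f x))"
  shows "grad_lap (\<lambda>x. \<phi> (f x)) x (\<phi>' (f x) *\<^sub>R g) (\<phi>' (f x) * h + c * (norm g)\<^sup>2)"
proof -
  obtain D H where 1: "\<forall>\<^sub>F y in nhds x. (f has_derivative (\<lambda>v. D y \<bullet> v)) (at y)" "D x = g"
    "\<And>i. ((\<lambda>y. D y $ i) has_derivative (\<lambda>v. H i \<bullet> v)) (at x)" "h = (\<Sum>i\<in>UNIV. H i $ i)"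
    using assms(1) unfolding grad_lap_def by blast
  have fd: "(f has_derivative (\<lambda>v. g \<bullet> v)) (at x)"
    using assms(1) by (rule grad_lap_has_derivative)
  have "isCont f x" using fd by (rule has_derivative_continuous)
  hence ev: "\<forall>\<^sub>F y in nhds x. (\<phi> has_real_derivative \<phi>' (f y)) (at (f y))"
    unfolding isCont_def tendsto_at_iff_tendsto_nhds by (rule eventually_compose_filterlim[OF \<phi>1])
  show ?thesis
  proof (rule grad_lapI[where D="\<lambda>y. \<phi>' (f y) *\<^sub>R D y" 
        and H="\<lambda>i. \<phi>' (f x) *\<^sub>R H i + (c * g $ i) *\<^sub>R g"])
    show "\<forall>\<^sub>F y in nhds x. ((\<lambda>x. \<phi> (f x)) has_derivative (\<bullet>) (\<phi>' (f y) *\<^sub>R D y)) (at y)"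
      using 1(1) ev
    proof eventually_elim
      case (elim y)
      show ?case
        using has_derivative_compose[OF elim(1) elim(2)[unfolded has_field_derivative_def]]
        by (auto simp: fun_eq_iff elim!: has_derivative_eq_rhs)
    qed
    show "((\<lambda>y. (\<phi>' (f y) *\<^sub>R D y) $ i) has_derivative (\<bullet>) (\<phi>' (f x) *\<^sub>R H i + (c * g $ i) *\<^sub>R g)) (at x)" for i
    proof -
      have "((\<lambda>y. \<phi>' (f y)) has_derivative (\<lambda>v. c * (g \<bullet> v))) (at x)"
        using has_derivative_compose[OF fd \<phi>2[unfolded has_field_derivative_def]]
        by (simp add: o_def)
      from has_derivative_mult[OF this 1(3)[of i]]
      show ?thesis
        by (auto simp: fun_eq_iff 1(2) inner_add_left algebra_simps elim!: has_derivative_eq_rhs)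
    qed
    show "\<phi>' (f x) * h + c * (norm g)\<^sup>2 = (\<Sum>i\<in>UNIV. (\<phi>' (f x) *\<^sub>R H i + (c * g $ i) *\<^sub>R g) $ i)"
      unfolding 1(4) power2_norm_eq_inner inner_vec_def
      by (simp add: sum.distrib sum_distrib_left algebra_simps)
  qed (simp add: 1)
qed

lemma grad_lap_affine:
  fixes x :: "real^'n"
  assumes "grad_lap f (a + c *\<^sub>R x) g h"
  shows "grad_lap (\<lambda>x. f (a + c *\<^sub>R x)) x (c *\<^sub>R g) (c\<^sup>2 * h)"
proof -
  obtain D H where 1: "\<forall>\<^sub>F y in nhds (a + c *\<^sub>R x). (f has_derivative (\<lambda>v. D y \<bullet> v)) (at y)"
    "D (a + c *\<^sub>R x) = g"
    "\<And>i. ((\<lambda>y. D y $ i) has_derivative (\<lambda>v. H i \<bullet> v)) (at (a + c *\<^sub>R x))" "h = (\<Sum>i\<in>UNIV. H i $ i)"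
    using assms(1) unfolding grad_lap_def by blast
  have lin: "((\<lambda>x. a + c *\<^sub>R x) has_derivative (\<lambda>v. c *\<^sub>R v)) (at y)" for y :: "real^'n"
    by (auto intro!: derivative_eq_intros)
  have "((\<lambda>x. a + c *\<^sub>R x) \<longlongrightarrow> a + c *\<^sub>R x) (nhds x)"
    by (intro tendsto_intros filterlim_ident)
  hence ev: "\<forall>\<^sub>F y in nhds x. (f has_derivative (\<lambda>v. D (a + c *\<^sub>R y) \<bullet> v)) (at (a + c *\<^sub>R y))"
    by (rule eventually_compose_filterlim[OF 1(1)])
  show ?thesis
  proof (rule grad_lapI[where D="\<lambda>y. c *\<^sub>R D (a + c *\<^sub>R y)" and H="\<lambda>i. c\<^sup>2 *\<^sub>R H i"])
    show "\<forall>\<^sub>F y in nhds x. ((\<lambda>x. f (a + c *\<^sub>R x)) has_derivative (\<bullet>) (c *\<^sub>R D (a + c *\<^sub>R y))) (at y)"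
      using ev
    proof eventually_elim
      case (elim y)
      show ?case
        using has_derivative_compose[OF lin elim]
        by (auto simp: fun_eq_iff elim!: has_derivative_eq_rhs)
    qed
    show "((\<lambda>y. (c *\<^sub>R D (a + c *\<^sub>R y)) $ i) has_derivative (\<bullet>) (c\<^sup>2 *\<^sub>R H i)) (at x)" for i
    proof -
      have "((\<lambda>y. D (a + c *\<^sub>R y) $ i) has_derivative (\<lambda>v. H i \<bullet> (c *\<^sub>R v))) (at x)"
        using has_derivative_compose[OF lin 1(3)[of i]] by (simp add: o_def)
      from has_derivative_mult_right[OF this, of c]
      show ?thesis
        by (auto simp: fun_eq_iff power2_eq_square elim!: has_derivative_eq_rhs)
    qed
  qed (simp_all add: 1 sum_distrib_left)
qed

lemma grad_lap_cmult:
  assumes "grad_lap f x g h"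
  shows "grad_lap (\<lambda>x. c * f x) x (c *\<^sub>R g) (c * h)"
  using grad_lap_compose[OF assms, of "\<lambda>s. c * s" "\<lambda>_. c" 0]
  by (auto intro!: derivative_eq_intros)

lemma grad_lap_diff:
  assumes "grad_lap f1 x g1 h1" "grad_lap f2 x g2 h2"
  shows "grad_lap (\<lambda>x. f1 x - f2 x) x (g1 - g2) (h1 - h2)"
  using grad_lap_add[OF assms(1) grad_lap_cmult[OF assms(2), of "-1"]] by simp

lemma grad_lap_norm_sq:
  "grad_lap (\<lambda>x. (norm (x - y))\<^sup>2) x (2 *\<^sub>R (x - y)) (2 * real CARD('n))" for x y :: "real^'n"
proof (rule grad_lapI[where D="\<lambda>x. 2 *\<^sub>R (x - y)" and H="\<lambda>i. 2 *\<^sub>R axis i 1"])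
  show "\<forall>\<^sub>F z in nhds x. ((\<lambda>x. (norm (x - y))\<^sup>2) has_derivative (\<bullet>) (2 *\<^sub>R (z - y))) (at z)"
    unfolding power2_norm_eq_inner
    by (intro always_eventually allI) (auto intro!: derivative_eq_intros simp: inner_commute)
  show "((\<lambda>x. (2 *\<^sub>R (x - y)) $ i) has_derivative (\<bullet>) (2 *\<^sub>R axis i 1)) (at x)" for i
    by (auto intro!: derivative_eq_intros bounded_linear_imp_has_derivative bounded_linear_vec_nth 
        simp: inner_axis')
qed auto

text \<open>Only earlier times are compared, because an extremum over a time interval may sit at its
  last instant.\<close>

lemma deriv_left_max_nonneg:
  fixes f :: "real \<Rightarrow> real"
  assumes "(f has_real_derivative \<tau>) (at t)" "d > 0" "\<And>s. t - d < s \<Longrightarrow> s < t \<Longrightarrow> f s \<le> f t"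
  shows "\<tau> \<ge> 0"
proof (rule ccontr)
  assume "\<not> \<tau> \<ge> 0"
  with DERIV_neg_dec_left[OF assms(1)] obtain e where e: "e > 0" "\<And>h. 0 < h \<Longrightarrow> h < e \<Longrightarrow> f t < f (t - h)"
    by (auto simp: not_le)
  define h where "h = min d e / 2"
  have "0 < h" "h < d" "h < e" using assms(2) e(1) by (auto simp: h_def)
  with e(2)[of h] assms(3)[of "t - h"] show False by auto
qed

lemma second_deriv_local_max:
  fixes f :: "real \<Rightarrow> real"
  assumes "\<forall>\<^sub>F s in nhds 0. (f has_real_derivative f' s) (at s)" "(f' has_real_derivative c) (at 0)"
    and "\<forall>\<^sub>F s in nhds 0. f s \<le> f 0"
  shows "f' 0 = 0" "c \<le> 0"
proof -
  from assms(1,3) have "\<forall>\<^sub>F s in nhds 0. (f has_real_derivative f' s) (at s) \<and> f s \<le> f 0"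
    by eventually_elim auto
  then obtain d where d: "d > 0" "\<And>s. \<bar>s\<bar> < d \<Longrightarrow> (f has_real_derivative f' s) (at s) \<and> f s \<le> f 0"
    unfolding eventually_nhds_metric dist_real_def by auto
  show f0: "f' 0 = 0"
    using DERIV_local_max[of f "f' 0" 0 d] d by force
  show "c \<le> 0"
  proof (rule ccontr)
    assume "\<not> c \<le> 0"
    with DERIV_pos_inc_right[OF assms(2)] obtain e where e: "e > 0" "\<And>h. 0 < h \<Longrightarrow> h < e \<Longrightarrow> 0 < f' h"
      by (auto simp: not_le f0)
    define h where "h = min d e / 2"
    have h: "0 < h" "h < d" "h < e" using d(1) e(1) by (auto simp: h_def)
    have "f 0 < f h"
    proof (rule DERIV_pos_imp_increasing_open[OF h(1)])
      fix s assume "0 < s" "s < h"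
      then show "\<exists>y. (f has_real_derivative y) (at s) \<and> y > 0" using d(2)[of s] e(2)[of s] h by auto
    next
      have "isCont f s" if "s \<in> {0..h}" for s
        using d(2)[of s] h(2) that DERIV_isCont by auto
      then show "continuous_on {0..h} f" by (simp add: continuous_at_imp_continuous_on)
    qed
    with d(2)[of h] h show False by auto
  qed
qed

text \<open>The one-variable test on each coordinate line gives the sign of each diagonal Hessian
  entry, and these add up to the trace.\<close>

lemma grad_lap_local_max:
  assumes "grad_lap f x g h" "\<forall>\<^sub>F y in nhds x. f y \<le> f x"
  shows "g = 0" "h \<le> 0"
proof -
  obtain D H where 1: "\<forall>\<^sub>F y in nhds x. (f has_derivative (\<lambda>v. D y \<bullet> v)) (at y)" "D x = g"
    "\<And>i. ((\<lambda>y. D y $ i) has_derivative (\<lambda>v. H i \<bullet> v)) (at x)" "h = (\<Sum>i\<in>UNIV. H i $ i)"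
    using assms(1) unfolding grad_lap_def by blast
  have *: "g $ i = 0 \<and> H i $ i \<le> 0" for i
  proof -
    let ?l = "\<lambda>s. x + s *\<^sub>R axis i (1::real)"
    have l: "(?l has_derivative (\<lambda>v. v *\<^sub>R axis i 1)) (at s)" for s
      by (auto intro!: derivative_eq_intros)
    have "(?l \<longlongrightarrow> x + 0 *\<^sub>R axis i 1) (nhds 0)" by (intro tendsto_intros filterlim_ident)
    hence flt: "filterlim ?l (nhds x) (nhds 0)" by simp
    have a: "\<forall>\<^sub>F s in nhds 0. ((\<lambda>s. f (?l s)) has_real_derivative D (?l s) $ i) (at s)"
      using flt[unfolded filterlim_iff, rule_format, OF 1(1)]
    proof eventually_elim
      case (elim s)
      show ?case using has_derivative_compose[OF l elim]
        by (simp add: has_field_derivative_def o_def inner_axis mult_commute_abs)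
    qed
    have b: "((\<lambda>s. D (?l s) $ i) has_real_derivative H i $ i) (at 0)"
      using has_derivative_compose[OF l[of 0], of "\<lambda>y. D y $ i" "\<lambda>v. H i \<bullet> v"] 1(3)[of i]
      by (simp add: has_field_derivative_def o_def inner_axis mult_commute_abs)
    have c: "\<forall>\<^sub>F s in nhds 0. f (?l s) \<le> f (?l 0)"
      using flt[unfolded filterlim_iff, rule_format, OF assms(2)] by simp
    from second_deriv_local_max[OF a b c] show ?thesis by (simp add: 1(2))
  qed
  then show "g = 0" by (simp add: vec_eq_iff)
  from * show "h \<le> 0" unfolding 1(4) by (auto intro: sum_nonpos)
qed

section \<open>One-sided bounds and growth\<close>

text \<open>Derivatives are quantified point by point, so that rescaled solutions are again
  instances without any derivative functions being named.\<close>

definition sol_at :: "real \<Rightarrow> (real^'n \<Rightarrow> real \<Rightarrow> real) \<Rightarrow> real^'n \<Rightarrow> real \<Rightarrow> bool" where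
  "sol_at p u x t \<longleftrightarrow> (\<exists>g h \<tau>. grad_lap (\<lambda>y. u y t) x g h
      \<and> (u x has_real_derivative \<tau>) (at t) \<and> \<tau> - h = norm g powr p)"

section \<open>Scale invariance and the barrier at unit scale\<close>

lemma powr_ge_square:
  assumes "a \<ge> 0" "p \<ge> (2::real)"
  shows "a powr p \<ge> a\<^sup>2 - 1"
proof (cases "a \<le> 1")
  case True
  then have "a\<^sup>2 \<le> 1" using assms by (simp add: power_le_one)
  then show ?thesis using powr_ge_zero[of a p] by linarith
next
  case False
  then have "a powr 2 \<le> a powr p" using assms by (intro powr_mono) auto
  then show ?thesis using False by simp
qed

text \<open>With \<open>k\<close> the prefactor, the gradient is multiplied by \<open>k * c\<close>
  and the left side of the equation by \<open>k * c\<^sup>2\<close>. The requirement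
  \<open>(k * c) powr p = k * c\<^sup>2\<close> is what determines the exponent.\<close>

lemma sol_at_rescale:
  assumes sol: "sol_at p u (a + c *\<^sub>R x) (b + c\<^sup>2 * t)" and c: "c > 0" and p: "p > 1"
  shows "sol_at p (\<lambda>x t. c powr (- ((p - 2) / (p - 1))) * u (a + c *\<^sub>R x) (b + c\<^sup>2 * t)) x t"
proof -
  obtain g h \<tau> where 1: "grad_lap (\<lambda>y. u y (b + c\<^sup>2 * t)) (a + c *\<^sub>R x) g h"
    and 2: "(u (a + c *\<^sub>R x) has_real_derivative \<tau>) (at (b + c\<^sup>2 * t))"
    and 3: "\<tau> - h = norm g powr p"
    using sol unfolding sol_at_def by blast
  define k where "k = c powr (- ((p - 2) / (p - 1)))"
  have k: "k > 0" using c by (simp add: k_def)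
  have kc: "k * c = c powr (1 / (p - 1))"
  proof -
    have "k * c = c powr (- ((p - 2) / (p - 1)) + 1)" 
      unfolding k_def using c powr_add[of c "- ((p - 2) / (p - 1))" 1] by simp
    also have "- ((p - 2) / (p - 1)) + 1 = 1 / (p - 1)" using p by (simp add: field_simps)
    finally show ?thesis .
  qed
  have "(k * c) powr p = c powr (p / (p - 1))" unfolding kc using c by (simp add: powr_powr)
  also have "p / (p - 1) = - ((p - 2) / (p - 1)) + 2" using p by (simp add: field_simps)
  also have "c powr \<dots> = k * c\<^sup>2" 
    using c powr_add[of c "- ((p - 2) / (p - 1))" 2] by (simp add: k_def)
  finally have kp: "(k * c) powr p = k * c\<^sup>2" .
  have gl: "grad_lap (\<lambda>y. k * u (a + c *\<^sub>R y) (b + c\<^sup>2 * t)) x (k *\<^sub>R c *\<^sub>R g) (k * (c\<^sup>2 * h))"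
    using grad_lap_cmult[OF grad_lap_affine[OF 1]] by simp
  have "((\<lambda>t. b + c\<^sup>2 * t) has_real_derivative c\<^sup>2) (at t)"
    by (auto intro!: derivative_eq_intros)
  from DERIV_cmult[OF DERIV_chain2[OF 2 this], of k]
  have td: "((\<lambda>t. k * u (a + c *\<^sub>R x) (b + c\<^sup>2 * t)) has_real_derivative k * (\<tau> * c\<^sup>2)) (at t)" .
  have "norm (k *\<^sub>R c *\<^sub>R g) powr p = (k * c) powr p * norm g powr p"
    using k c by (simp add: powr_mult mult.assoc)
  also have "\<dots> = k * (\<tau> * c\<^sup>2) - k * (c\<^sup>2 * h)" unfolding kp 3[symmetric] by algebra
  finally show ?thesis unfolding sol_at_def k_def[symmetric] using gl td by metis
qed

text \<open>This is the inequality that remains at a touching point, with \<open>Y\<close> standing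
  for t / (t - |x|^2). The quartic from the gradient term absorbs the rest: the cubic terms cost
  \<open>2 * Y^4 + 18 * Y\<^sup>2\<close>, and since \<open>2 * n + 1 = m - 18\<close> this
  \<open>18 * Y\<^sup>2\<close> is already paid for; \<open>m * Y\<^sup>2\<close> costs
  \<open>Y^4 + m\<^sup>2 / 4\<close>.\<close>

lemma barrier_arith:
  fixes Y n :: real
  assumes "Y \<ge> 1" "n \<ge> 0"
  shows "(2 * n + 1) * Y\<^sup>2 + 8 * (Y\<^sup>2 * (Y - 1)) + 1 - (4 * Y^4 - 4 * Y^3) < (2 * n + 19)\<^sup>2"
proof -
  define m where "m = 2 * n + 19"
  have "0 \<le> 2 * (Y * (Y - 3))\<^sup>2" "0 \<le> (Y\<^sup>2 - m / 2)\<^sup>2" "0 \<le> Y ^ 4" by auto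
  then have "12 * Y^3 \<le> 2 * Y^4 + 18 * Y\<^sup>2" "m * Y\<^sup>2 \<le> Y^4 + m\<^sup>2 / 4" "0 \<le> Y ^ 4"
    by (simp_all add: power2_eq_square power4_eq_xxxx power3_eq_cube algebra_simps)
  moreover have "2 * 2 \<le> m * m" using assms by (intro mult_mono) (auto simp: m_def)
  moreover have "(2 * n + 1) * Y\<^sup>2 + 8 * (Y\<^sup>2 * (Y - 1)) + 1 - (4 * Y^4 - 4 * Y^3)
      = m * Y\<^sup>2 - 26 * Y\<^sup>2 + 12 * Y^3 + 1 - 4 * Y^4"
    by (simp add: m_def power2_eq_square power3_eq_cube algebra_simps)
  moreover have "0 \<le> Y\<^sup>2" by simp
  ultimately show ?thesis unfolding m_def[symmetric] power2_eq_square[of m] by linarith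
qed

lemma deriv_inverse_square:
  fixes s t c :: real
  assumes "s \<noteq> t"
  shows "((\<lambda>s. c / (t - s)\<^sup>2) has_real_derivative 2 * c / (t - s) ^ 3) (at s)"
proof -
  have "c * (2 * w) / (w\<^sup>2 * w\<^sup>2) = 2 * c / w ^ 3" if "w \<noteq> 0" for w :: real
    using that by (simp add: field_simps power2_eq_square power3_eq_cube)
  moreover have "- (c * (2 * s - 2 * t)) = c * (2 * (t - s))" by (simp add: algebra_simps)
  ultimately have "- (c * (2 * s - 2 * t)) / ((t - s)\<^sup>2 * (t - s)\<^sup>2) = 2 * c / (t - s) ^ 3"
    using assms by (metis right_minus_eq)
  then show ?thesis
    using assms by (auto intro!: derivative_eq_intros simp: power2_eq_square)
qed

lemma deriv_barrier:
  fixes t r \<beta> E :: real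
  assumes "t > 0" "r \<noteq> t"
  shows "((\<lambda>s. s powr (\<beta> + 1) / (s - r) + E * s powr \<beta>) has_real_derivative
    (\<beta> + 1) * t powr \<beta> / (t - r) - t powr (\<beta> + 1) / (t - r)\<^sup>2 + E * (\<beta> * t powr (\<beta> - 1))) (at t)"
proof -
  have pw: "((\<lambda>s. s powr c) has_real_derivative c * t powr (c - 1)) (at t)" for c
    using assms by (intro DERIV_cong[OF has_real_derivative_powr]) auto
  have ln: "((\<lambda>s. s - r) has_real_derivative 1) (at t)"
    by (auto intro!: derivative_eq_intros)
  have eq: "(A * w - B * 1) / (w * w) + C = A / w - B / w\<^sup>2 + C" if "w \<noteq> 0" for A B C w :: real
    using that by (simp add: field_simps power2_eq_square)
  have "t - r \<noteq> 0" using assms by simp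
  from DERIV_add[OF DERIV_divide[OF pw[of "\<beta> + 1"] ln this] DERIV_cmult[OF pw[of \<beta>], of E]]
  show ?thesis unfolding eq[OF \<open>t - r \<noteq> 0\<close>] by simp
qed

text \<open>The comparison function blows up on the lateral boundary of the paraboloid
  \<open>norm x ^ 2 < t\<close>, so it can only touch \<open>u\<close> inside; near the vertex \<open>u\<close> is almost constant.\<close>

lemma supersolution_lower_bound_unit:
  fixes u :: "real^'n \<Rightarrow> real \<Rightarrow> real" and p :: real
  defines "\<beta> \<equiv> (p - 2) / (2 * (p - 1))"
  defines "E \<equiv> (2 * real CARD('n) + 19)\<^sup>2 / \<beta>"
  assumes p: "p > 2"
    and sol: "\<And>x t. norm x \<le> 1 \<Longrightarrow> 0 \<le> t \<Longrightarrow> t \<le> 1 \<Longrightarrow> sol_at p u x t"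
    and cont: "continuous_on (cball 0 1 \<times> {0..1}) (\<lambda>(x,t). u x t)"
    and x1: "norm x1 \<le> 1 / 2"
  shows "u x1 1 \<ge> u 0 0 - (4 / 3 + E)"
proof (rule ccontr)
  have \<beta>: "\<beta> > 0" using p by (simp add: \<beta>_def)
  have E: "E > 0" unfolding E_def using \<beta> by (intro divide_pos_pos) (auto intro!: zero_less_power add_nonneg_pos)
  \<comment> \<open>The barrier is t^\<beta> times a function of |x|^2 / t, hence self-similar under
    parabolic scaling, with \<beta> half of \<alpha>. At \<open>(x1, 1)\<close> it is at most
    \<open>4 / 3 + E\<close>, so the negated claim makes \<open>f\<close> negative there.\<close>
  define f where "f = (\<lambda>(x, t). u x t - u 0 0 + (t powr (\<beta> + 1) / (t - (norm x)\<^sup>2) + E * t powr \<beta>))"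
  define \<gamma> where "\<gamma> = - f (x1, 1)"
  have x1sq: "(norm x1)\<^sup>2 \<le> 1 / 4" using power_mono[OF x1, of 2] by (simp add: power2_eq_square)
  assume "\<not> u x1 1 \<ge> u 0 0 - (4 / 3 + E)"
  moreover have "1 / (1 - (norm x1)\<^sup>2) \<le> 4 / 3" using x1sq by (simp add: field_simps)
  ultimately have \<gamma>: "\<gamma> > 0" by (simp add: \<gamma>_def f_def)
  let ?S = "cball (0::real^'n) 1 \<times> {0..1::real}"
  have "compact ?S" by (intro compact_Times compact_cball compact_Icc)
  from compact_imp_bounded[OF compact_continuous_image[OF cont this]]
  obtain M0 where M0: "\<And>z. z \<in> ?S \<Longrightarrow> \<bar>(\<lambda>(x,t). u x t) z\<bar> \<le> M0" unfolding bounded_iff by force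
  define M where "M = 2 * M0"
  have M: "\<bar>u x t - u 0 0\<bar> \<le> M" if "norm x \<le> 1" "0 \<le> t" "t \<le> 1" for x t
    using M0[of "(x, t)"] M0[of "(0, 0)"] that by (simp add: M_def)
  have M_nn: "M \<ge> 0" using M[of 0 0] by simp
  obtain d where d: "d > 0" "\<And>x t. norm x \<le> 1 \<Longrightarrow> 0 \<le> t \<Longrightarrow> t \<le> 1 \<Longrightarrow> dist (x, t) (0, 0) < d \<Longrightarrow> \<bar>u x t - u 0 0\<bar> < \<gamma>"
    using cont[unfolded continuous_on_iff, rule_format, of "(0,0)" \<gamma>] \<gamma> by (auto simp: dist_real_def)
  \<comment> \<open>The region starts at time \<epsilon> rather than 0. Its slice there lies in a
    ball of radius \<open>e\<close>, on which \<open>u\<close> differs from \<open>u 0 0\<close> by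
    less than \<gamma>, so the minimum is not on the bottom.\<close>
  define e where "e = min 1 d / 4"
  define \<epsilon> where "\<epsilon> = e\<^sup>2"
  have e: "0 < e" "e \<le> 1 / 4" "e \<le> d / 4" using d by (auto simp: e_def)
  have \<epsilon>: "0 < \<epsilon>" "\<epsilon> \<le> e" using e mult_left_mono[of e 1 e] by (auto simp: \<epsilon>_def power2_eq_square)
  have init: "u x \<epsilon> - u 0 0 > - \<gamma>" if "(norm x)\<^sup>2 \<le> \<epsilon>" for x
  proof -
    have "norm x \<le> e" using that e by (simp add: \<epsilon>_def power2_le_iff_abs_le)
    moreover have "dist (x, \<epsilon>) (0, 0) \<le> norm x + \<epsilon>"
      using norm_Pair_le[of x \<epsilon>] \<epsilon> by (simp add: dist_norm)
    ultimately have "\<bar>u x \<epsilon> - u 0 0\<bar> < \<gamma>" using e \<epsilon> d(1) by (intro d(2)) auto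
    then show ?thesis by linarith
  qed
  \<comment> \<open>Where \<open>t - (norm x)\<^sup>2 = \<eta>\<close> the barrier is at least
    \<open>M + 1\<close>, more than \<open>u - u 0 0\<close> can compensate; this excludes the
    lateral boundary.\<close>
  define \<eta> where "\<eta> = min (\<epsilon> powr (\<beta> + 1) / (M + 1)) (1 / 2)"
  have \<eta>: "0 < \<eta>" "\<eta> \<le> 1 / 2" "\<eta> \<le> \<epsilon> powr (\<beta> + 1) / (M + 1)"
    using \<epsilon> M_nn min.cobounded2[of "\<epsilon> powr (\<beta> + 1) / (M + 1)" "1 / 2"] unfolding \<eta>_def by simp_all
  define A where "A = {z :: (real^'n) \<times> real. \<epsilon> \<le> snd z \<and> snd z \<le> 1 \<and> (norm (fst z))\<^sup>2 \<le> snd z - \<eta>}"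
  have A_sub: "A \<subseteq> ?S"
  proof
    fix z assume z: "z \<in> A"
    then have "(norm (fst z))\<^sup>2 \<le> 1\<^sup>2" using \<eta> by (simp add: A_def)
    then have "norm (fst z) \<le> 1" by (simp only: power2_le_iff_abs_le)
    then show "z \<in> ?S" using z \<epsilon> by (simp add: A_def mem_Times_iff)
  qed
  have "closed A" unfolding A_def
    by (intro closed_Collect_conj closed_Collect_le continuous_intros)
  with A_sub have "compact A"
    using \<open>compact ?S\<close> by (metis compact_Int_closed inf.absorb2)
  moreover have "(x1, 1) \<in> A" using x1sq \<eta> \<epsilon> e by (simp add: A_def)
  moreover have "continuous_on A f"
  proof -
    have "continuous_on A (\<lambda>z. u (fst z) (snd z))"
      using continuous_on_subset[OF cont A_sub] by (simp add: case_prod_unfold)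
    then show ?thesis unfolding f_def case_prod_unfold using \<epsilon> \<eta>
      by (intro continuous_intros) (auto simp: A_def)
  qed
  ultimately obtain z where z: "z \<in> A" "\<And>y. y \<in> A \<Longrightarrow> f z \<le> f y"
    using continuous_attains_inf[of A f] by blast
  obtain x t where xt: "z = (x, t)" by (cases z)
  have A: "\<epsilon> \<le> t" "t \<le> 1" "(norm x)\<^sup>2 \<le> t - \<eta>" using z(1) by (auto simp: A_def xt)
  have xt1: "norm x \<le> 1" "0 \<le> t" using A_sub z(1) by (auto simp: xt)
  have fz: "f (x, t) \<le> - \<gamma>" using z(2)[OF \<open>(x1, 1) \<in> A\<close>] by (simp add: \<gamma>_def xt)
  have "t \<noteq> \<epsilon>"
  proof
    assume "t = \<epsilon>"
    moreover have "t powr (\<beta> + 1) / (t - (norm x)\<^sup>2) + E * t powr \<beta> \<ge> 0"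
      using A \<eta> E by (intro add_nonneg_nonneg divide_nonneg_nonneg) auto
    ultimately show False using fz init[of x] A \<eta> by (simp add: f_def)
  qed
  with A have t: "\<epsilon> < t" by simp
  have "(norm x)\<^sup>2 \<noteq> t - \<eta>"
  proof
    assume w: "(norm x)\<^sup>2 = t - \<eta>"
    have "M + 1 \<le> \<epsilon> powr (\<beta> + 1) / \<eta>" using \<eta> M_nn by (simp add: field_simps)
    also have "\<dots> \<le> t powr (\<beta> + 1) / \<eta>" using \<eta> t \<epsilon> \<beta> by (intro divide_right_mono powr_mono2) auto
    finally have "M + 1 \<le> t powr (\<beta> + 1) / \<eta> + E * t powr \<beta>" using E by (smt (verit) mult_nonneg_nonneg powr_ge_zero)
    then show False using M[of x t] A xt1 fz \<gamma> by (simp add: f_def w)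
  qed
  with A have xlt: "(norm x)\<^sup>2 < t - \<eta>" by simp
  define w where "w = t - (norm x)\<^sup>2"
  have w: "w > 0" "w \<le> t" using xlt \<eta> by (auto simp: w_def)
  have t0: "t > 0" using t \<epsilon> by simp
  obtain g h \<tau> where gl: "grad_lap (\<lambda>y. u y t) x g h"
    and ut: "(u x has_real_derivative \<tau>) (at t)" and eq: "\<tau> - h = norm g powr p"
    using sol[of x t] A xt1 unfolding sol_at_def by blast
  \<comment> \<open>In terms of \<open>P\<close> and \<open>Y\<close> every term of the touching
    inequality carries the factor \<open>P\<close>, and what is left depends on \<open>Y\<close>
    alone.\<close>
  define P where "P = t powr (\<beta> - 1)"
  define Y where "Y = t / w"
  have P: "P > 0" using t0 by (simp add: P_def)
  have Pt: "t powr \<beta> = P * t" "t powr (\<beta> + 1) = P * t\<^sup>2"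
    using t0 powr_add[of t "\<beta> - 1" 1] powr_add[of t "\<beta> - 1" 2] by (auto simp: P_def add.commute)
  have Y: "Y \<ge> 1" using w by (simp add: Y_def)
  have rw: "(norm x)\<^sup>2 / w = Y - 1" using w by (simp add: Y_def w_def field_simps)
  let ?\<phi> = "\<lambda>s. t powr (\<beta> + 1) / (t - s)"
  let ?\<phi>' = "\<lambda>s. t powr (\<beta> + 1) / (t - s)\<^sup>2"
  have \<phi>1: "\<forall>\<^sub>F s in nhds ((norm (x - 0))\<^sup>2). (?\<phi> has_real_derivative ?\<phi>' s) (at s)"
  proof -
    have "\<forall>\<^sub>F s in nhds ((norm (x - 0))\<^sup>2). s < t"
      using w by (intro eventually_nhds_in_open[of "{..<t}", simplified]) (auto simp: w_def)
    then show ?thesis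
      by eventually_elim (auto intro!: derivative_eq_intros simp: power2_eq_square)
  qed
  have \<phi>2: "(?\<phi>' has_real_derivative 2 * (t powr (\<beta> + 1)) / w ^ 3) (at ((norm (x - 0))\<^sup>2))"
    using w deriv_inverse_square[of "(norm x)\<^sup>2" t "t powr (\<beta> + 1)"] by (simp add: w_def)
  have glb: "grad_lap (\<lambda>x. ?\<phi> ((norm (x - 0))\<^sup>2)) x ((P * t\<^sup>2 / w\<^sup>2) *\<^sub>R (2 *\<^sub>R (x - 0)))
      ((P * t\<^sup>2 / w\<^sup>2) * (2 * real CARD('n)) + (2 * (P * t\<^sup>2) / w ^ 3) * (norm (2 *\<^sub>R (x - 0)))\<^sup>2)"
    using grad_lap_compose[OF grad_lap_norm_sq \<phi>1 \<phi>2] by (simp add: w_def[symmetric] Pt)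
  from grad_lap_cmult[OF grad_lap_add[OF gl glb], of "-1"]
  have glm: "grad_lap (\<lambda>x. - (u x t + ?\<phi> ((norm (x - 0))\<^sup>2))) x (- (g + (P * t\<^sup>2 / w\<^sup>2) *\<^sub>R (2 *\<^sub>R (x - 0))))
      (- (h + ((P * t\<^sup>2 / w\<^sup>2) * (2 * real CARD('n)) + (2 * (P * t\<^sup>2) / w ^ 3) * (norm (2 *\<^sub>R (x - 0)))\<^sup>2)))"
    by simp
  have "\<forall>\<^sub>F y in nhds x. (norm y)\<^sup>2 < t - \<eta>"
    using xlt by (intro eventually_nhds_in_open[of "{y. (norm y)\<^sup>2 < t - \<eta>}", simplified] open_Collect_less continuous_intros) auto
  then have "\<forall>\<^sub>F y in nhds x. - (u y t + ?\<phi> ((norm (y - 0))\<^sup>2)) \<le> - (u x t + ?\<phi> ((norm (x - 0))\<^sup>2))"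
  proof eventually_elim
    case (elim y)
    then have "(y, t) \<in> A" using A by (simp add: A_def)
    from z(2)[OF this] show ?case by (simp add: f_def xt)
  qed
  note mx = grad_lap_local_max[OF glm this]
  have g: "g = - ((2 * P * t\<^sup>2 / w\<^sup>2) *\<^sub>R x)"
  proof -
    have "g + (P * t\<^sup>2 / w\<^sup>2) *\<^sub>R (2 *\<^sub>R (x - 0)) = 0" using mx(1) by (metis neg_equal_0_iff_equal)
    moreover have "(P * t\<^sup>2 / w\<^sup>2) *\<^sub>R (2 *\<^sub>R (x - 0)) = (2 * P * t\<^sup>2 / w\<^sup>2) *\<^sub>R x" by simp
    ultimately show ?thesis by (metis eq_neg_iff_add_eq_0)
  qed
  have "- h \<le> (P * t\<^sup>2 / w\<^sup>2) * (2 * real CARD('n)) + (2 * (P * t\<^sup>2) / w ^ 3) * (4 * (norm x)\<^sup>2)"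
    using mx(2) by (simp add: power_mult_distrib)
  also have "(2 * (P * t\<^sup>2) / w ^ 3) * (4 * (norm x)\<^sup>2) = P * 8 * Y\<^sup>2 * ((norm x)\<^sup>2 / w)"
    using w by (simp add: Y_def field_simps power2_eq_square power3_eq_cube)
  also have "(P * t\<^sup>2 / w\<^sup>2) * (2 * real CARD('n)) = P * (2 * real CARD('n) * Y\<^sup>2)"
    by (simp add: Y_def power_divide)
  finally have h: "- h \<le> P * (2 * real CARD('n) * Y\<^sup>2) + P * 8 * Y\<^sup>2 * (Y - 1)" by (simp add: rw)
  have "((\<lambda>s. - f (x, s)) has_real_derivative - (\<tau> + ((\<beta> + 1) * t powr \<beta> / w - t powr (\<beta> + 1) / w\<^sup>2 + E * (\<beta> * t powr (\<beta> - 1))))) (at t)"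
    unfolding f_def case_prod_conv w_def
    by (intro DERIV_cong[OF DERIV_minus[OF DERIV_add[OF DERIV_diff[OF ut DERIV_const] deriv_barrier]]])
      (use w in \<open>simp_all add: w_def t0\<close>)
  moreover have "- f (x, s) \<le> - f (x, t)" if "t - min (t - \<epsilon>) (t - \<eta> - (norm x)\<^sup>2) < s" "s < t" for s
  proof -
    have "(x, s) \<in> A" using that A by (auto simp: A_def)
    from z(2)[OF this] show ?thesis by (simp add: xt)
  qed
  ultimately have "0 \<le> - (\<tau> + ((\<beta> + 1) * t powr \<beta> / w - t powr (\<beta> + 1) / w\<^sup>2 + E * (\<beta> * t powr (\<beta> - 1))))"
    using t xlt by (intro deriv_left_max_nonneg[of _ _ t "min (t - \<epsilon>) (t - \<eta> - (norm x)\<^sup>2)"]) auto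
  also have "(\<beta> + 1) * t powr \<beta> / w = P * ((\<beta> + 1) * Y)" by (simp add: Pt Y_def)
  also have "t powr (\<beta> + 1) / w\<^sup>2 = P * Y\<^sup>2" by (simp add: Pt Y_def power_divide)
  also have "E * (\<beta> * t powr (\<beta> - 1)) = P * (2 * real CARD('n) + 19)\<^sup>2" using \<beta> by (simp add: P_def E_def)
  finally have "\<tau> \<le> P * Y\<^sup>2 - P * (2 * real CARD('n) + 19)\<^sup>2 - P * ((\<beta> + 1) * Y)" by linarith
  moreover have "P * ((\<beta> + 1) * Y) \<ge> 0" using P \<beta> Y by simp
  ultimately have "\<tau> \<le> P * Y\<^sup>2 - P * (2 * real CARD('n) + 19)\<^sup>2" by linarith
  \<comment> \<open>The value of \<beta> is chosen for
    \<open>(\<beta> - 1 / 2) * p = \<beta> - 1\<close>: the p-th power of the gradient then has the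
    same factor \<open>P\<close> as the time derivative and the Laplacian.\<close>
  define a where "a = 2 * norm x * Y\<^sup>2 / sqrt t"
  have "norm g = (P * sqrt t) * a"
    using P t0 w by (simp add: g a_def Y_def power_divide abs_mult)
  moreover have "a \<ge> 0" using t0 by (simp add: a_def)
  ultimately have "norm g powr p = (P * sqrt t) powr p * a powr p"
    using P t0 by (simp only: powr_mult)
  also have "P * sqrt t = t powr (\<beta> - 1 / 2)"
    using t0 by (simp add: P_def powr_half_sqrt[symmetric] powr_add[symmetric])
  also have "\<dots> powr p = P"
  proof -
    have "(\<beta> - 1 / 2) * p = \<beta> - 1" using p by (simp add: \<beta>_def field_simps)
    then show ?thesis by (simp add: P_def powr_powr)
  qed
  finally have gp: "norm g powr p = P * a powr p" .
  \<comment> \<open>Replacing the power by a square, at the cost of 1, makes the remaining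
    inequality polynomial in \<open>Y\<close>.\<close>
  have ap: "a powr p \<ge> a\<^sup>2 - 1" using p \<open>a \<ge> 0\<close> by (intro powr_ge_square) auto
  have "a\<^sup>2 = 4 * Y ^ 4 * ((norm x)\<^sup>2 / t)"
    using t0 by (simp add: a_def power_mult_distrib power_divide flip: power_mult)
  also have "(norm x)\<^sup>2 / t = 1 - 1 / Y" by (simp add: Y_def w_def order_less_imp_not_eq2[OF t0] diff_divide_distrib)
  also have "4 * Y ^ 4 * (1 - 1 / Y) = 4 * Y ^ 4 - 4 * Y ^ 3"
    using Y by (simp add: field_simps power4_eq_xxxx power3_eq_cube)
  finally have "P * (4 * Y ^ 4 - 4 * Y ^ 3 - 1) \<le> norm g powr p" using P ap by (simp add: gp)
  also have "\<dots> \<le> P * Y\<^sup>2 - P * (2 * real CARD('n) + 19)\<^sup>2 + (P * (2 * real CARD('n) * Y\<^sup>2) + P * 8 * Y\<^sup>2 * (Y - 1))"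
    using eq h \<open>\<tau> \<le> P * Y\<^sup>2 - P * (2 * real CARD('n) + 19)\<^sup>2\<close> by linarith
  also have "\<dots> = P * ((2 * real CARD('n) + 1) * Y\<^sup>2 + 8 * (Y\<^sup>2 * (Y - 1)) - (2 * real CARD('n) + 19)\<^sup>2)"
    by (simp add: algebra_simps)
  finally have "4 * Y ^ 4 - 4 * Y ^ 3 - 1 \<le> (2 * real CARD('n) + 1) * Y\<^sup>2 + 8 * (Y\<^sup>2 * (Y - 1)) - (2 * real CARD('n) + 19)\<^sup>2"
    using P by simp
  with barrier_arith[OF Y, of "real CARD('n)"] show False by simp
qed

text \<open>An upper bound of the barrier at time 1 on |x| \<le> 1/2: \<open>4 / 3\<close> bounds 1
  / (1 - |x|^2), and the quotient is the coefficient \<open>E\<close>, whose time derivative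
  dominates the polynomial of \<open>barrier_arith\<close>.\<close>

definition hoelder_const :: "real \<Rightarrow> nat \<Rightarrow> real" where
  "hoelder_const p n = 4 / 3 + (2 * real n + 19)\<^sup>2 / ((p - 2) / (2 * (p - 1)))"

lemma hoelder_const_nonneg: "p > 2 \<Longrightarrow> hoelder_const p n \<ge> 0"
  unfolding hoelder_const_def by (intro add_nonneg_nonneg divide_nonneg_nonneg) auto

lemma norm_axis_real [simp]: "norm (axis k r :: real^'n) = \<bar>r\<bar>"
proof -
  have "axis k r = r *\<^sub>R (axis k 1 :: real^'n)" by (simp add: vec_eq_iff axis_def)
  then show ?thesis by simp
qed

lemma continuous_on_rescale:
  fixes u :: "'a::real_normed_vector \<Rightarrow> real \<Rightarrow> real"
  assumes "continuous_on S (\<lambda>(x, t). u x t)"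
    and "\<And>x t. (x, t) \<in> T \<Longrightarrow> (a + c *\<^sub>R x, b + d * t) \<in> S"
  shows "continuous_on T (\<lambda>(x, t). k * u (a + c *\<^sub>R x) (b + d * t))"
proof -
  have "continuous_on T (\<lambda>z. (\<lambda>(x, t). u x t) (a + c *\<^sub>R fst z, b + d * snd z))"
    by (rule continuous_on_compose2[OF assms(1)]) (use assms(2) in \<open>auto intro!: continuous_intros\<close>)
  then show ?thesis by (auto simp: case_prod_unfold intro!: continuous_intros)
qed

lemma supersolution_lower_bound:
  fixes u :: "real^'n \<Rightarrow> real \<Rightarrow> real"
  assumes p: "p > 2" and R: "R > 0"
    and sol: "\<And>x t. norm (x - y) \<le> R \<Longrightarrow> s \<le> t \<Longrightarrow> t \<le> s + R\<^sup>2 \<Longrightarrow> sol_at p u x t"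
    and cont: "continuous_on (cball y R \<times> {s..s + R\<^sup>2}) (\<lambda>(x,t). u x t)"
    and x: "norm (x - y) \<le> R / 2"
  shows "u x (s + R\<^sup>2) \<ge> u y s - hoelder_const p CARD('n) * R powr ((p - 2) / (p - 1))"
proof -
  define c where "c = R powr (- ((p - 2) / (p - 1)))"
  define v where "v = (\<lambda>x t. c * u (y + R *\<^sub>R x) (s + R\<^sup>2 * t))"
  have c: "c > 0" using R by (simp add: c_def)
  have "v ((1 / R) *\<^sub>R (x - y)) 1 \<ge> v 0 0 - hoelder_const p CARD('n)"
    unfolding hoelder_const_def
  proof (rule supersolution_lower_bound_unit[OF p])
    fix x :: "real^'n" and t :: real
    assume a: "norm x \<le> 1" "0 \<le> t" "t \<le> 1"
    show "sol_at p v x t" unfolding v_def c_def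
      by (rule sol_at_rescale[OF sol]) (use a R p in \<open>auto simp: mult_left_le\<close>)
  next
    show "continuous_on (cball 0 1 \<times> {0..1}) (\<lambda>(x, t). v x t)"
      unfolding v_def by (rule continuous_on_rescale[OF cont])
        (use R in \<open>auto simp: dist_norm mult_left_le\<close>)
    next
    show "norm ((1 / R) *\<^sub>R (x - y)) \<le> 1 / 2" using x R by (simp add: pos_divide_le_eq)
  qed
  then have "c * (u y s - hoelder_const p CARD('n) / c) \<le> c * u x (s + R\<^sup>2)"
    using R c by (simp add: v_def right_diff_distrib)
  then have "u y s - hoelder_const p CARD('n) / c \<le> u x (s + R\<^sup>2)" using c by simp
  then show ?thesis by (simp add: c_def powr_minus divide_inverse)
qed

section \<open>Chaining the lower bound to the boundary\<close>

locale half_space_solution =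
  fixes p :: real and k :: "'n::finite" and u :: "real^'n \<Rightarrow> real \<Rightarrow> real"
  assumes p: "p > 2"
    and sol: "\<And>x t. x $ k > 0 \<Longrightarrow> sol_at p u x t"
    and cont: "continuous_on ({x. x $ k \<ge> 0} \<times> UNIV) (\<lambda>(x, t). u x t)"
    and boundary: "\<And>x t. x $ k = 0 \<Longrightarrow> u x t = 0"
begin

abbreviation \<alpha> :: real where "\<alpha> \<equiv> (p - 2) / (p - 1)"

lemma lower_bound:
  assumes "y $ k > R" "R > 0" "norm (x - y) \<le> R / 2"
  shows "u y s - hoelder_const p CARD('n) * R powr \<alpha> \<le> u x (s + R\<^sup>2)"
proof -
  have pos: "z $ k > 0" if "norm (z - y) \<le> R" for z
    using component_le_norm_cart[of "z - y" k] that assms(1) by simp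
  show ?thesis
  proof (rule supersolution_lower_bound[OF p assms(2) _ _ assms(3)])
    show "continuous_on (cball y R \<times> {s..s + R\<^sup>2}) (\<lambda>(x, t). u x t)"
      by (rule continuous_on_subset[OF cont]) (use pos in \<open>auto simp: dist_norm norm_minus_commute intro: less_imp_le\<close>)
  qed (use pos sol in auto)
qed

text \<open>The lower bound is used with radius \<open>r / 2\<close>, which is below both heights
  \<open>r\<close> and \<open>3 / 4 * r\<close>, so either point may serve as the centre. Centring
  at \<open>x\<close> bounds \<open>u\<close> from above by a later value nearer to the boundary;
  centring at the lower point bounds \<open>u\<close> from below by an earlier one.\<close>

lemma step_bound:
  assumes "x $ k = r" "r > 0" "\<sigma> = 1 \<or> \<sigma> = -1"
  shows "\<sigma> * u x t \<le> \<sigma> * u (x - axis k (r / 4)) (t + \<sigma> * r\<^sup>2 / 4) + hoelder_const p CARD('n) * r powr \<alpha>"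
proof -
  let ?y = "x - axis k (r / 4)"
  have n: "norm (?y - x) = r / 4" "norm (x - ?y) = r / 4"
    using assms by simp_all
  have "(r / 2) powr \<alpha> \<le> r powr \<alpha>" using assms p by (intro powr_mono2) auto
  with hoelder_const_nonneg[OF p]
  have le: "hoelder_const p CARD('n) * (r / 2) powr \<alpha> \<le> hoelder_const p CARD('n) * r powr \<alpha>"
    by (rule mult_left_mono[rotated])
  show ?thesis using assms(3)
  proof
    assume "\<sigma> = 1"
    then show ?thesis using lower_bound[of "r / 2" x ?y t] n assms le by (simp add: power_divide)
  next
    assume "\<sigma> = -1"
    then show ?thesis using lower_bound[of "r / 2" ?y x "t - r\<^sup>2 / 4"] n assms le by (simp add: power_divide axis_def)
  qed
qed

text \<open>The geometric sum of all step costs: each step multiplies the height by 3/4, hence the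
  cost by (3/4)^\<alpha>.\<close>

definition growth_const :: real where
  "growth_const = hoelder_const p CARD('n) / (1 - (3 / 4) powr \<alpha>)"

lemma growth_const_nonneg: "growth_const \<ge> 0"
proof -
  have "(3 / 4) powr \<alpha> \<le> (1::real)" using p by (intro powr_le1) auto
  then show ?thesis unfolding growth_const_def using hoelder_const_nonneg[OF p] by (intro divide_nonneg_nonneg) auto
qed

text \<open>The time steps shrink with ratio 9/16, so the chain reaches a boundary point at a finite
  time, in the future for \<sigma> = 1 and in the past for \<sigma> = -1. Continuity up to the
  boundary makes the end value vanish, and only the geometric sum remains.\<close>

lemma abs_le_growth:
  assumes r: "x $ k > 0"
  shows "\<bar>u x t\<bar> \<le> growth_const * (x $ k) powr \<alpha>"
proof -
  define r where "r = x $ k"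
  define C where "C = hoelder_const p CARD('n)"
  define q where "q = (3 / 4 :: real) powr \<alpha>"
  have r: "r > 0" using assms by (simp add: r_def)
  have C: "C \<ge> 0" unfolding C_def by (rule hoelder_const_nonneg[OF p])
  have "q < (3 / 4) powr 0" unfolding q_def using p by (intro powr_less_mono') auto
  then have q: "0 < q" "q < 1" by (simp_all add: q_def)
  define xs where "xs j = x - axis k ((1 - (3 / 4) ^ j) * r)" for j
  define ts where "ts j = (\<Sum>i<j. r\<^sup>2 / 4 * (9 / 16) ^ i)" for j
  have xk: "xs j $ k = (3 / 4) ^ j * r" for j by (simp add: xs_def axis_def r_def algebra_simps)
  have main: "\<sigma> * u x t \<le> growth_const * r powr \<alpha>" if \<sigma>: "\<sigma> = 1 \<or> \<sigma> = -1" for \<sigma>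
  proof -
    define F where "F j = \<sigma> * u (xs j) (t + \<sigma> * ts j)" for j
    have step: "F j \<le> F (Suc j) + C * r powr \<alpha> * q ^ j" for j
    proof -
      have a: "xs (Suc j) = xs j - axis k ((3 / 4) ^ j * r / 4)"
        by (simp add: xs_def vec_eq_iff axis_def algebra_simps)
      have b: "ts (Suc j) = ts j + ((3 / 4) ^ j * r)\<^sup>2 / 4"
        by (simp add: ts_def power2_eq_square flip: power_mult_distrib)
      have c: "((3 / 4) ^ j * r) powr \<alpha> = r powr \<alpha> * q ^ j"
        using r by (simp add: powr_mult q_def powr_powr[symmetric] powr_realpow[symmetric] mult.commute powr_powr)
      show ?thesis
        using step_bound[OF xk[of j] _ \<sigma>, of "t + \<sigma> * ts j"] r
        by (simp add: F_def C_def a b c) (simp add: algebra_simps)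
    qed
    have s1: "F 0 \<le> F j + C * r powr \<alpha> * (\<Sum>i<j. q ^ i)" for j
    proof (induction j)
      case (Suc j)
      then show ?case using step[of j] by (simp add: algebra_simps)
    qed simp
    have s2: "C * r powr \<alpha> * (\<Sum>i<j. q ^ i) \<le> C * r powr \<alpha> * (1 / (1 - q))" for j
    proof (rule mult_left_mono)
      have "(\<Sum>i<j. q ^ i) \<le> (\<Sum>i. q ^ i)"
        using q by (intro sum_le_suminf summable_geometric) auto
      then show "(\<Sum>i<j. q ^ i) \<le> 1 / (1 - q)" using q by (simp add: suminf_geometric)
    qed (use C in auto)
    have "C * r powr \<alpha> * (1 / (1 - q)) = growth_const * r powr \<alpha>"
      by (simp add: growth_const_def C_def q_def)
    then have bd: "F 0 \<le> F j + growth_const * r powr \<alpha>" for j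
      using s1[of j] s2[of j] by linarith
    have lim: "F \<longlonglongrightarrow> 0"
    proof -
      have "(\<lambda>j. (3 / 4) ^ j :: real) \<longlonglongrightarrow> 0" by (rule LIMSEQ_realpow_zero) auto
      then have "(\<lambda>j. (1 - (3 / 4) ^ j) * r) \<longlonglongrightarrow> (1 - 0) * r"
        by (intro tendsto_mult tendsto_diff tendsto_const)
      then have xl: "xs \<longlonglongrightarrow> x - axis k ((1 - 0) * r)"
        unfolding xs_def
        by (intro tendsto_diff tendsto_const bounded_linear.tendsto[of "axis k"]) 
           (auto intro!: linear_conv_bounded_linear[THEN iffD1] linearI simp: vec_eq_iff axis_def)
      have "summable (\<lambda>i. r\<^sup>2 / 4 * (9 / 16 :: real) ^ i)" by (intro summable_mult summable_geometric) auto
      then have tl: "ts \<longlonglongrightarrow> (\<Sum>i. r\<^sup>2 / 4 * (9 / 16) ^ i)"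
        unfolding ts_def by (rule summable_LIMSEQ)
      let ?z = "(x - axis k ((1 - 0) * r), t + \<sigma> * (\<Sum>i. r\<^sup>2 / 4 * (9 / 16) ^ i))"
      have "(\<lambda>j. (xs j, t + \<sigma> * ts j)) \<longlonglongrightarrow> ?z"
        by (intro tendsto_Pair xl tendsto_intros tl)
      from continuous_on_tendsto_compose[OF cont this]
      have "(\<lambda>j. u (xs j) (t + \<sigma> * ts j)) \<longlonglongrightarrow> (\<lambda>(x, t). u x t) ?z"
        using r by (simp add: xk axis_def r_def[symmetric])
      also have "(\<lambda>(x, t). u x t) ?z = 0" unfolding case_prod_conv by (rule boundary) (simp add: r_def axis_def)
      finally show ?thesis unfolding F_def using tendsto_mult_right_zero by blast
    qed
    have "F 0 \<le> 0 + growth_const * r powr \<alpha>"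
      by (rule LIMSEQ_le_const[OF tendsto_add[OF lim tendsto_const]]) (use bd in auto)
    then show ?thesis by (simp add: F_def xs_def ts_def axis_def vec_eq_iff zero_vec_def[symmetric])
  qed
  show ?thesis using main[of 1] main[of "-1"] by (simp add: r_def abs_le_iff)
qed

end

section \<open>Interior gradient estimate\<close>

lemma one_minus_powr_ge:
  fixes x p :: real
  assumes "0 \<le> x" "x \<le> 1" "p \<ge> 1"
  shows "1 - p * x \<le> (1 - x) powr p"
proof (cases "x = 1")
  case False
  then have x: "x < 1" using assms by simp
  have d: "((\<lambda>s. (1 - s) powr p + p * s) has_real_derivative p * (1 - (1 - s) powr (p - 1))) (at s)"
    if "0 \<le> s" "s \<le> x" for s
    using that x by (auto intro!: derivative_eq_intros simp: algebra_simps)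
  have "(1 - 0) powr p + p * 0 \<le> (1 - x) powr p + p * x"
  proof (rule DERIV_nonneg_imp_nondecreasing[OF assms(1)])
    fix s assume s: "0 \<le> s" "s \<le> x"
    then have "(1 - s) powr (p - 1) \<le> 1" using x assms by (intro powr_le1) auto
    then have "0 \<le> p * (1 - (1 - s) powr (p - 1))" using assms by (intro mult_nonneg_nonneg) auto
    with d[OF s] show "\<exists>y. ((\<lambda>s. (1 - s) powr p + p * s) has_real_derivative y) (at s) \<and> 0 \<le> y"
      by blast
  qed
  then show ?thesis by simp
qed (use assms in simp)

text \<open>This compares the right sides of the equation for \<open>w\<close> at two points, with
  \<open>wx\<close> above \<open>wy\<close>. The exponential weight gains a relative amount
  \<open>(p - 1) * L * q\<close>, where \<open>q = r * Z\<close>, while the mismatch of the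
  gradients costs only multiples of \<open>q\<close>. For large \<open>L\<close> a share
  \<open>q * L / 2\<close> survives; times \<open>G\<^sup>2\<close> it exceeds the localisation
  error of order \<open>L * r * Z ^ 3\<close>.\<close>

lemma doubling_arith:
  fixes p L Z r b G D gx wx wy n :: real
  assumes p: "p > 2" and Z: "Z \<ge> 1" and r: "r > 0" and b: "b \<ge> 0" "L * r * Z \<le> b"
    and G: "G = L * Z" and D: "D \<le> 2 * L * r * Z\<^sup>2" and gx: "gx \<ge> 0" "\<bar>gx - G\<bar> \<le> D"
    and w: "wx - wy \<ge> L * r * Z" "wy \<ge> 0" and n: "n \<ge> 0"
    and L: "L \<ge> 2 * n + 30 + 4 * p + 4 * p * b + 4 * b"
  shows "gx\<^sup>2 - G\<^sup>2 - exp ((p - 1) * wx) * gx powr p + exp ((p - 1) * wy) * G powr p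
    < - (L * r * ((2 * n + 9) * Z ^ 3))"
proof -
  define q where "q = r * Z"
  have pb: "0 \<le> p * b" using p b by simp
  have L1: "L \<ge> 30" using L n p b pb by linarith
  have q: "q > 0" using r Z by (simp add: q_def)
  have Lq: "L * q \<le> b" using b by (simp add: q_def mult.assoc)
  \<comment> \<open>Together with \<open>L * q \<le> b\<close> this gives
    \<open>q \<le> 1 / 4\<close>, which keeps \<open>1 - 2 * q\<close> positive.\<close>
  have "4 * b \<le> L" using L n p b pb by linarith
  with Lq have "4 * (L * q) \<le> L * 1" by linarith
  then have "L * (4 * q) \<le> L * 1" by simp
  then have q4: "q \<le> 1 / 4" using L1 by simp
  have G1: "G \<ge> 1" using L1 Z mult_mono[of 1 L 1 Z] by (simp add: G)
  have D2: "D \<le> 2 * q * G" using D by (simp add: q_def G power2_eq_square mult_ac)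
  have D0: "D \<ge> 0" using gx(2) by linarith
  have sq: "gx\<^sup>2 - G\<^sup>2 \<le> 6 * q * G\<^sup>2"
  proof -
    have "gx\<^sup>2 \<le> (G + 2 * q * G)\<^sup>2" using gx D2 by (intro power_mono) linarith+
    also have "\<dots> = G\<^sup>2 + 4 * q * G\<^sup>2 + 4 * q * (q * G\<^sup>2)" by (simp add: power2_eq_square algebra_simps)
    also have "4 * q * (q * G\<^sup>2) \<le> 2 * (q * G\<^sup>2)" using q q4 by (intro mult_right_mono) auto
    finally show ?thesis by (simp add: algebra_simps)
  qed
  define A where "A = exp ((p - 1) * wy)"
  have A: "A \<ge> 1" using p w by (simp add: A_def)
  have "A * (1 + (p - 1) * (L * q)) \<le> A * exp ((p - 1) * (wx - wy))"
  proof (rule mult_left_mono)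
    have "(p - 1) * (L * q) \<le> (p - 1) * (wx - wy)" using p w by (intro mult_left_mono) (auto simp: q_def mult.assoc)
    also have "\<dots> \<le> exp ((p - 1) * (wx - wy)) - 1" using exp_ge_add_one_self[of "(p - 1) * (wx - wy)"] by linarith
    finally show "1 + (p - 1) * (L * q) \<le> exp ((p - 1) * (wx - wy))" by linarith
  qed (use A in simp)
  also have "\<dots> = exp ((p - 1) * wx)" by (simp add: A_def exp_add[symmetric] algebra_simps)
  finally have ex: "A * (1 + (p - 1) * (L * q)) \<le> exp ((p - 1) * wx)" .
  have "G powr p * (1 - p * (2 * q)) \<le> G powr p * (1 - 2 * q) powr p"
    using one_minus_powr_ge[of "2 * q" p] q q4 p by (intro mult_left_mono) auto
  also have "\<dots> = (G * (1 - 2 * q)) powr p" using G1 q4 by (simp add: powr_mult)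
  also have "\<dots> \<le> gx powr p" using gx D2 G1 q4 p by (intro powr_mono2) (auto simp: algebra_simps)
  finally have gxp: "G powr p * (1 - p * (2 * q)) \<le> gx powr p" .
  have "A * (1 + (p - 1) * (L * q)) * (G powr p * (1 - p * (2 * q))) \<le> exp ((p - 1) * wx) * gx powr p"
  proof -
    have "A * (1 + (p - 1) * (L * q)) * (G powr p * (1 - p * (2 * q))) \<le> A * (1 + (p - 1) * (L * q)) * gx powr p"
      using A p L1 q by (intro mult_left_mono[OF gxp]) auto
    also have "\<dots> \<le> exp ((p - 1) * wx) * gx powr p" using ex by (intro mult_right_mono) auto
    finally show ?thesis .
  qed
  moreover have "A * G powr p * (q * L / 2) \<le> A * (1 + (p - 1) * (L * q)) * (G powr p * (1 - p * (2 * q))) - A * G powr p"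
  proof -
    \<comment> \<open>The summands \<open>4 * p\<close> and \<open>4 * p * b\<close> in the lower
      bound on \<open>L\<close> pay for the linear and the quadratic loss, the latter through
      \<open>L * q \<le> b\<close>.\<close>
    have "q * L / 2 \<le> (1 + (p - 1) * (L * q)) * (1 - p * (2 * q)) - 1"
    proof -
      have e: "(1 + (p - 1) * (L * q)) * (1 - p * (2 * q)) - 1 = q * ((p - 1) * L - 2 * p - 2 * p * (p - 1) * (L * q))"
        by (simp add: algebra_simps)
      have "2 * p * (p - 1) * (L * q) \<le> 2 * p * (p - 1) * b" using p Lq by (intro mult_left_mono) auto
      moreover have "(p - 1) * (4 * p + 4 * p * b) \<le> (p - 1) * L" using p n b L by (intro mult_left_mono) auto
      moreover have "1 * (4 * p) \<le> (p - 1) * (4 * p)" "1 * L \<le> (p - 1) * L" using p L1 by (intro mult_right_mono; simp)+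
      ultimately have "L / 2 \<le> (p - 1) * L - 2 * p - 2 * p * (p - 1) * (L * q)"
        by (simp add: algebra_simps)
      then have "q * (L / 2) \<le> q * ((p - 1) * L - 2 * p - 2 * p * (p - 1) * (L * q))"
        using q by (intro mult_left_mono) auto
      then show ?thesis unfolding e by simp
    qed
    then have "(A * G powr p) * (q * L / 2) \<le> (A * G powr p) * ((1 + (p - 1) * (L * q)) * (1 - p * (2 * q)) - 1)"
      using A by (intro mult_left_mono) auto
    then show ?thesis by (simp add: algebra_simps)
  qed
  moreover have "G\<^sup>2 * (q * L / 2) \<le> A * G powr p * (q * L / 2)"
  proof (rule mult_right_mono)
    have "G\<^sup>2 = G powr 2" using G1 by simp
    also have "\<dots> \<le> G powr p" using G1 p by (intro powr_mono) auto
    also have "\<dots> \<le> A * G powr p" using A mult_right_mono[of 1 A "G powr p"] by simp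
    finally show "G\<^sup>2 \<le> A * G powr p" .
  qed (use q L1 in simp)
  ultimately have "gx\<^sup>2 - G\<^sup>2 - exp ((p - 1) * wx) * gx powr p + A * G powr p \<le> 6 * q * G\<^sup>2 - G\<^sup>2 * (q * L / 2)"
    using sq by linarith
  also have "\<dots> = (L * r * Z ^ 3) * (6 * L - L * L / 2)"
    by (simp add: G q_def power2_eq_square power3_eq_cube algebra_simps)
  also have "\<dots> < (L * r * Z ^ 3) * (- (2 * n + 9))"
  proof (rule mult_strict_left_mono)
    have "L * (2 * n + 30) \<le> L * L" using L n p b L1 pb by (intro mult_left_mono) linarith+
    moreover have "30 * n \<le> L * n" using L1 n by (intro mult_right_mono) auto
    ultimately show "6 * L - L * L / 2 < - (2 * n + 9)" using L1 n by (simp add: algebra_simps)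
  qed (use L1 r Z in simp)
  also have "\<dots> = - (L * r * ((2 * n + 9) * Z ^ 3))" by (simp add: algebra_simps)
  finally show ?thesis by (simp add: A_def)
qed

section \<open>Logarithmic transform and gradient estimate at unit scale\<close>

definition log_sol_at :: "real \<Rightarrow> (real^'n \<Rightarrow> real \<Rightarrow> real) \<Rightarrow> real^'n \<Rightarrow> real \<Rightarrow> bool" where
  "log_sol_at p w x t \<longleftrightarrow> (\<exists>g h \<tau>. grad_lap (\<lambda>y. w y t) x g h
      \<and> (w x has_real_derivative \<tau>) (at t)
      \<and> \<tau> - h = (norm g)\<^sup>2 - exp ((p - 1) * w x t) * norm g powr p)"

lemma grad_lap_ln_diff:
  assumes "grad_lap f x g h" "f x < M"
  shows "grad_lap (\<lambda>x. ln (M - f x)) x (- (1 / (M - f x)) *\<^sub>R g)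
    (- (h / (M - f x)) - (norm g)\<^sup>2 / (M - f x)\<^sup>2)"
proof -
  have "\<forall>\<^sub>F s in nhds (f x). s < M"
    using assms(2) by (intro eventually_nhds_in_open[of "{..<M}", simplified]) auto
  then have 1: "\<forall>\<^sub>F s in nhds (f x). ((\<lambda>s. ln (M - s)) has_real_derivative - (1 / (M - s))) (at s)"
    by eventually_elim (auto intro!: derivative_eq_intros)
  have 2: "((\<lambda>s. - (1 / (M - s))) has_real_derivative - (1 / (M - f x)\<^sup>2)) (at (f x))"
    using assms(2) by (auto intro!: derivative_eq_intros simp: power2_eq_square)
  from grad_lap_compose[OF assms(1) 1 2] show ?thesis by simp
qed

text \<open>Dividing by \<open>V = M - u\<close> turns the source \<open>norm g powr p\<close> into
  an absorption term, because
  \<open>V powr (p - 1) * (norm g / V) powr p = norm g powr p / V\<close>. Its weight is increasing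
  in the logarithm, which gives the doubling argument its sign.\<close>

lemma log_sol_at_ln:
  assumes sol: "sol_at p u x t" and M: "u x t < M"
  shows "log_sol_at p (\<lambda>x t. ln (M - u x t)) x t"
proof -
  obtain g h \<tau> where 1: "grad_lap (\<lambda>y. u y t) x g h"
    and 2: "(u x has_real_derivative \<tau>) (at t)" and 3: "\<tau> - h = norm g powr p"
    using sol unfolding sol_at_def by blast
  define V where "V = M - u x t"
  have V: "V > 0" using M by (simp add: V_def)
  have "((\<lambda>s. ln (M - u x s)) has_real_derivative - (\<tau> / V)) (at t)"
    using V by (auto intro!: derivative_eq_intros 2 simp: V_def)
  moreover have "- (\<tau> / V) - (- (h / V) - (norm g)\<^sup>2 / V\<^sup>2)
      = (norm (- (1 / V) *\<^sub>R g))\<^sup>2 - exp ((p - 1) * ln V) * norm (- (1 / V) *\<^sub>R g) powr p"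
  proof -
    have n: "norm (- (1 / V) *\<^sub>R g) = norm g / V" using V by simp
    have e: "exp ((p - 1) * ln V) = V powr (p - 1)" using V by (simp add: powr_def)
    have "V powr (p - 1) * (norm g / V) powr p = norm g powr p / V"
      using V by (simp add: powr_divide powr_diff)
    then show ?thesis unfolding n e 3[symmetric] by (simp add: power_divide diff_divide_distrib)
  qed
  ultimately show ?thesis unfolding log_sol_at_def
    using grad_lap_ln_diff[OF 1 M] by (metis V_def)
qed


lemma grad_lap_inverse_ball:
  fixes x :: "real^'n"
  assumes "norm x < 1"
  defines "a \<equiv> 1 / (1 - (norm x)\<^sup>2)"
  shows "grad_lap (\<lambda>x. 1 / (1 - (norm x)\<^sup>2)) x ((2 * a\<^sup>2) *\<^sub>R x)
    (2 * real CARD('n) * a\<^sup>2 + 8 * (norm x)\<^sup>2 * a ^ 3)"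
proof -
  have w: "(norm x)\<^sup>2 < 1" using assms by (simp add: abs_square_less_1)
  then have "\<forall>\<^sub>F s in nhds ((norm (x - 0))\<^sup>2). s < 1"
    by (intro eventually_nhds_in_open[of "{..<1}", simplified]) auto
  then have 1: "\<forall>\<^sub>F s in nhds ((norm (x - 0))\<^sup>2). ((\<lambda>s. 1 / (1 - s)) has_real_derivative 1 / (1 - s)\<^sup>2) (at s)"
    by eventually_elim (auto intro!: derivative_eq_intros simp: power2_eq_square)
  have 2: "((\<lambda>s. 1 / (1 - s)\<^sup>2) has_real_derivative 2 * 1 / (1 - (norm (x - 0))\<^sup>2) ^ 3) (at ((norm (x - 0))\<^sup>2))"
    using w by (intro deriv_inverse_square) auto
  show ?thesis using grad_lap_compose[OF grad_lap_norm_sq 1 2]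
    by (simp add: a_def power_divide power_mult_distrib mult_ac)
qed

text \<open>Doubling of variables with both points moved by the same vector: the weight multiplies
  \<open>norm (x - y)\<close>, so every localisation error carries that factor and is absorbed by the gain
  coming from the weight \<open>exp ((p - 1) * w)\<close> in the equation for \<open>w\<close>.\<close>

lemma log_sol_lipschitz_at_origin:
  fixes w :: "real^'n \<Rightarrow> real \<Rightarrow> real"
  assumes p: "p > 2" and b: "b \<ge> 0"
    and sol: "\<And>x t. norm x \<le> 2 \<Longrightarrow> -1 \<le> t \<Longrightarrow> t \<le> 0 \<Longrightarrow> log_sol_at p w x t"
    and bnd: "\<And>x t. norm x \<le> 2 \<Longrightarrow> -1 \<le> t \<Longrightarrow> t \<le> 0 \<Longrightarrow> 0 \<le> w x t \<and> w x t \<le> b"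
    and cont: "continuous_on (cball 0 2 \<times> {-1..0}) (\<lambda>(x,t). w x t)"
    and L: "L \<ge> 2 * real CARD('n) + 30 + 4 * p + 4 * p * b + 4 * b"
    and y0: "norm y0 \<le> 2"
  shows "w 0 0 - w y0 0 \<le> 2 * L * norm y0"
proof (rule ccontr)
  define \<delta> where "\<delta> = w 0 0 - w y0 0 - 2 * L * norm y0"
  assume "\<not> w 0 0 - w y0 0 \<le> 2 * L * norm y0"
  then have \<delta>: "\<delta> > 0" by (simp add: \<delta>_def)
  \<comment> \<open>\<open>L > b\<close> will force the two points to be less than 1 apart, which
    keeps \<open>y\<close> off the sphere of radius 2.\<close>
  have L1: "L > 1" "L > b"
  proof -
    have "0 \<le> p * b" using p b by simp
    then show "L > 1" "L > b" using L p b by linarith+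
  qed
  let ?S = "cball (0::real^'n) 2 \<times> {-1..0::real}"
  have "compact ?S" by (intro compact_Times compact_cball compact_Icc)
  \<comment> \<open>Uniform continuity keeps the two points at least \<eta> apart at the maximum;
    there the norm is differentiable, and the weight is bounded in terms of
    \<open>b\<close>.\<close>
  from compact_uniformly_continuous[OF cont this] \<delta> obtain \<eta> where \<eta>: "\<eta> > 0"
    and uc: "\<And>z z'. z \<in> ?S \<Longrightarrow> z' \<in> ?S \<Longrightarrow> dist z' z < \<eta> \<Longrightarrow>
      dist ((\<lambda>(x,t). w x t) z') ((\<lambda>(x,t). w x t) z) < \<delta>"
    unfolding uniformly_continuous_on_def by metis
  \<comment> \<open>The weight becomes infinite at |x| = 1 and t = -1. Its value 2 at the origin is
    the factor 2 in the claim.\<close>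
  define Z where "Z = (\<lambda>(x :: real^'n) t :: real. 1 / (1 - (norm x)\<^sup>2) + 1 / (1 + t))"
  define \<Phi> where "\<Phi> = (\<lambda>(x, y, t). w x t - w y t - L * norm (x - y) * Z x t)"
  \<comment> \<open>The maximum is taken over a compact set cut off at level \<open>m\<close>. Since
    L \<eta> Z stays below \<open>b + 1\<close> at the maximum, each summand of the weight is below
    \<open>1 / m\<close>, so the cut is not attained.\<close>
  define m where "m = min (1 / 2) (L * \<eta> / (b + 1))"
  have m: "0 < m" "m \<le> 1 / 2" "m \<le> L * \<eta> / (b + 1)"
    using L1 \<eta> b min.cobounded1[of "1 / 2" "L * \<eta> / (b + 1)"] unfolding m_def by simp_all
  define K where "K = {z :: (real^'n) \<times> (real^'n) \<times> real.
    (norm (fst z))\<^sup>2 \<le> 1 - m \<and> norm (fst (snd z)) \<le> 2 \<and> -1 + m \<le> snd (snd z) \<and> snd (snd z) \<le> 0}"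
  have inK: "norm x < 1 \<and> norm x \<le> 2 \<and> -1 \<le> t" if "(x, y, t) \<in> K" for x y t
  proof -
    have "(norm x)\<^sup>2 < 1" using that m by (simp add: K_def)
    then have "norm x < 1" by (simp add: abs_square_less_1)
    then show ?thesis using that m by (simp add: K_def)
  qed
  have K_sub: "K \<subseteq> cball 0 2 \<times> cball 0 2 \<times> {-1..0}"
    using inK by (force simp: K_def)
  have "closed K" unfolding K_def
    by (intro closed_Collect_conj closed_Collect_le continuous_intros)
  moreover have "compact (cball (0::real^'n) 2 \<times> cball (0::real^'n) 2 \<times> {-1..0::real})"
    by (intro compact_Times compact_cball compact_Icc)
  ultimately have "compact K" using K_sub by (metis compact_Int_closed inf.absorb2)
  moreover have K0: "(0, y0, 0) \<in> K" using m y0 by (simp add: K_def)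
  moreover have "continuous_on K \<Phi>"
  proof -
    have 1: "continuous_on K (\<lambda>z. (\<lambda>(x,t). w x t) (fst z, snd (snd z)))"
      "continuous_on K (\<lambda>z. (\<lambda>(x,t). w x t) (fst (snd z), snd (snd z)))"
      by (rule continuous_on_compose2[OF cont], intro continuous_intros, use K_sub in force)+
    then show ?thesis unfolding \<Phi>_def Z_def case_prod_unfold using m
      by (intro continuous_intros) (auto simp: K_def)
  qed
  ultimately obtain z where z: "z \<in> K" "\<And>z'. z' \<in> K \<Longrightarrow> \<Phi> z' \<le> \<Phi> z"
    using continuous_attains_sup[of K \<Phi>] by blast
  obtain x y t where xyt: "z = (x, y, t)" by (cases z)
  define r where "r = norm (x - y)"
  define a where "a = 1 / (1 - (norm x)\<^sup>2)"
  define s where "s = 1 / (1 + t)"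
  note zK = z(1)[unfolded xyt]
  have x: "norm x < 1" "(norm x)\<^sup>2 \<le> 1 - m" and y: "norm y \<le> 2" and t: "-1 + m \<le> t" "t \<le> 0"
    using inK[OF zK] zK by (auto simp: K_def)
  have a: "a \<ge> 1" using x m by (simp add: a_def)
  have s: "s \<ge> 1" using t m by (simp add: s_def)
  have Zxt: "Z x t = a + s" by (simp add: Z_def a_def s_def)
  have "\<Phi> (0, y0, 0) \<le> \<Phi> (x, y, t)" using z(2)[OF K0] by (simp add: xyt)
  then have \<Phi>: "\<delta> + L * r * (a + s) \<le> w x t - w y t"
    by (simp add: \<Phi>_def \<delta>_def Zxt r_def) (simp add: Z_def)
  have Lr0: "L * r * (a + s) \<ge> 0" using L1 a s by (simp add: r_def)
  have r: "r \<ge> \<eta>"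
  proof (rule ccontr)
    assume "\<not> r \<ge> \<eta>"
    then have "dist (x, t) (y, t) < \<eta>" by (simp add: dist_Pair_Pair r_def dist_norm)
    from uc[OF _ _ this] have "\<bar>w x t - w y t\<bar> < \<delta>" using x y t m by (simp add: dist_real_def)
    with \<Phi> Lr0 show False by linarith
  qed
  have Lrb: "L * r * (a + s) < b"
    using \<Phi> \<delta> bnd[of x t] bnd[of y t] x y t m by linarith
  have small: "c < 1 / m" if "c \<le> a + s" "c \<ge> 0" for c
  proof -
    have "L * \<eta> * c \<le> L * r * (a + s)" using that L1 r \<eta> by (intro mult_mono) auto
    then have "L * \<eta> * c < b + 1" using Lrb by linarith
    then have "c < (b + 1) / (L * \<eta>)" using L1 \<eta> by (simp add: field_simps)
    also have "\<dots> \<le> 1 / m" using m L1 \<eta> b by (simp add: field_simps)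
    finally show ?thesis .
  qed
  have x2: "(norm x)\<^sup>2 < 1 - m"
    using small[of a] a s x m by (simp add: a_def divide_less_eq less_divide_eq)
  have t2: "-1 + m < t"
    using small[of s] a s t m by (simp add: s_def divide_less_eq less_divide_eq)
  have y2: "norm y < 2"
  proof -
    have "L * r * 1 \<le> L * r * (a + s)" using a s L1 by (intro mult_left_mono) (auto simp: r_def)
    then have "L * r < L * 1" using Lrb L1 by linarith
    then have "r < 1" using L1 by simp
    then show ?thesis using norm_triangle_ineq4[of x "x - y"] x by (simp add: r_def)
  qed
  obtain gx hx \<tau>x where X: "grad_lap (\<lambda>y. w y t) x gx hx" "(w x has_real_derivative \<tau>x) (at t)"
    "\<tau>x - hx = (norm gx)\<^sup>2 - exp ((p - 1) * w x t) * norm gx powr p"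
    using sol[of x t] x t m unfolding log_sol_at_def by auto
  obtain gy hy \<tau>y where Y: "grad_lap (\<lambda>y. w y t) y gy hy" "(w y has_real_derivative \<tau>y) (at t)"
    "\<tau>y - hy = (norm gy)\<^sup>2 - exp ((p - 1) * w y t) * norm gy powr p"
    using sol[of y t] y t m unfolding log_sol_at_def by auto
  define gZ hZ where "gZ = (2 * a\<^sup>2) *\<^sub>R x" and "hZ = 2 * real CARD('n) * a\<^sup>2 + 8 * (norm x)\<^sup>2 * a ^ 3"
  have gZ: "grad_lap (\<lambda>x. Z x t) x (gZ + 0) (hZ + 0)"
    unfolding Z_def gZ_def hZ_def a_def by (intro grad_lap_add grad_lap_inverse_ball grad_lap_const x)
  have shift: "grad_lap (\<lambda>\<xi>. f (v + 1 *\<^sub>R \<xi>)) 0 g h" if "grad_lap f v g h" for f g h and v :: "real^'n"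
    using grad_lap_affine[of f v 1 0 g h] that by simp
  have ev: "\<forall>\<^sub>F \<xi> in nhds 0. (norm (x + 1 *\<^sub>R \<xi>))\<^sup>2 < 1 - m \<and> norm (y + 1 *\<^sub>R \<xi>) < 2"
  proof -
    have "open {\<xi>. (norm (x + 1 *\<^sub>R \<xi>))\<^sup>2 < 1 - m \<and> norm (y + 1 *\<^sub>R \<xi>) < 2}"
      by (intro open_Collect_conj open_Collect_less continuous_intros)
    from eventually_nhds_in_open[OF this, of 0] show ?thesis using x2 y2 by simp
  qed
  have "\<forall>\<^sub>F \<xi> in nhds 0. w (x + 1 *\<^sub>R \<xi>) t - w (y + 1 *\<^sub>R \<xi>) t - L * r * Z (x + 1 *\<^sub>R \<xi>) t
      \<le> w (x + 1 *\<^sub>R 0) t - w (y + 1 *\<^sub>R 0) t - L * r * Z (x + 1 *\<^sub>R 0) t"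
    using ev
  proof eventually_elim
    case (elim \<xi>)
    then have "(x + \<xi>, y + \<xi>, t) \<in> K" using t by (simp add: K_def)
    from z(2)[OF this] show ?case by (simp add: xyt \<Phi>_def r_def)
  qed
  note tr = grad_lap_local_max[OF grad_lap_diff[OF grad_lap_diff[OF shift[OF X(1)] shift[OF Y(1)]]
        grad_lap_cmult[OF shift[OF gZ], of "L * r"]] this]
  have gx_eq: "gx = gy + (L * r) *\<^sub>R gZ" using tr(1) by (simp add: algebra_simps)
  have hxy: "hx - hy \<le> L * r * hZ" using tr(2) by simp
  \<comment> \<open>Here \<open>y\<close> moves alone. The weight does not involve \<open>y\<close>,
    so stationarity fixes the length of the gradient at \<open>y\<close> exactly.\<close>
  have gyn: "norm gy = L * (a + s)"
  proof -
    have rp: "r > 0" using r \<eta> by simp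
    have "x \<noteq> y" using rp by (auto simp: r_def)
    have "\<forall>\<^sub>F v in nhds ((norm (y - x))\<^sup>2). 0 < v"
      using \<open>x \<noteq> y\<close> by (intro eventually_nhds_in_open[of "{0<..}", simplified]) auto
    then have 1: "\<forall>\<^sub>F v in nhds ((norm (y - x))\<^sup>2). (sqrt has_real_derivative (inverse (sqrt v) / 2)) (at v)"
      by eventually_elim (rule DERIV_real_sqrt)
    have "\<exists>c. ((\<lambda>v. inverse (sqrt v) / 2) has_real_derivative c) (at ((norm (y - x))\<^sup>2))"
      using \<open>x \<noteq> y\<close> by (intro exI) (auto intro!: derivative_eq_intros)
    then obtain c where 2: "((\<lambda>v. inverse (sqrt v) / 2) has_real_derivative c) (at ((norm (y - x))\<^sup>2))" ..
    have "(inverse (sqrt ((norm (y - x))\<^sup>2)) / 2) *\<^sub>R (2 *\<^sub>R (y - x)) = (1 / r) *\<^sub>R (y - x)"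
      by (simp add: r_def norm_minus_commute[of x y] inverse_eq_divide)
    with grad_lap_compose[OF grad_lap_norm_sq 1 2] obtain h
      where dst: "grad_lap (\<lambda>y. norm (y - x)) y ((1 / r) *\<^sub>R (y - x)) h"
      by (simp only: real_sqrt_abs abs_norm_cancel)
    have "\<forall>\<^sub>F v in nhds y. norm v < 2"
      using y2 by (intro eventually_nhds_in_open[of "{v. norm v < 2}", simplified] open_Collect_less continuous_intros) auto
    then have "\<forall>\<^sub>F v in nhds y. (w x t - w v t) - L * (a + s) * norm (v - x) \<le> (w x t - w y t) - L * (a + s) * norm (y - x)"
    proof eventually_elim
      case (elim v)
      then have "(x, v, t) \<in> K" using t x by (simp add: K_def)
      from z(2)[OF this] show ?case by (simp add: xyt \<Phi>_def Zxt norm_minus_commute mult_ac)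
    qed
    from grad_lap_local_max(1)[OF grad_lap_diff[OF grad_lap_diff[OF grad_lap_const Y(1)]
          grad_lap_cmult[OF dst, of "L * (a + s)"]] this]
    have "gy = - ((L * (a + s)) *\<^sub>R (1 / r) *\<^sub>R (y - x))" by (simp add: algebra_simps)
    then show ?thesis using L1 a s rp by (simp add: r_def norm_minus_commute)
  qed
  have tau: "\<tau>x - \<tau>y \<ge> - (L * r * s\<^sup>2)"
  proof -
    have "((\<lambda>v. w x v - w y v - L * r * Z x v) has_real_derivative \<tau>x - \<tau>y - L * r * (0 - s\<^sup>2)) (at t)"
      unfolding Z_def using t m
      by (auto intro!: derivative_eq_intros X(2) Y(2) simp: s_def power2_eq_square)
    moreover have "w x v - w y v - L * r * Z x v \<le> w x t - w y t - L * r * Z x t" if "t - (t - (-1 + m)) < v" "v < t" for v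
    proof -
      have "(x, y, v) \<in> K" using that t x y by (simp add: K_def)
      from z(2)[OF this] show ?thesis by (simp add: xyt \<Phi>_def r_def)
    qed
    ultimately have "0 \<le> \<tau>x - \<tau>y - L * r * (0 - s\<^sup>2)"
      using t2 by (intro deriv_left_max_nonneg[of _ _ t "t - (-1 + m)"]) auto
    then show ?thesis by simp
  qed
  define D where "D = norm ((L * r) *\<^sub>R gZ)"
  have D: "D \<le> 2 * L * r * (a + s)\<^sup>2"
  proof -
    have "norm gZ \<le> 2 * a\<^sup>2 * 1" unfolding gZ_def norm_scaleR using x by (simp add: mult_left_le)
    also have "\<dots> \<le> 2 * (a + s)\<^sup>2" using a s by (simp add: power_mono)
    finally have "L * r * norm gZ \<le> L * r * (2 * (a + s)\<^sup>2)"
      using L1 by (intro mult_left_mono) (auto simp: r_def)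
    then show ?thesis using L1 by (simp add: D_def r_def mult_ac)
  qed
  \<comment> \<open>The constant is 2n + 8 from the Laplacian of the weight plus 1 from its time
    derivative; since \<open>a + s\<close> is at least 1, all powers are absorbed by the
    cube.\<close>
  have "hZ + s\<^sup>2 \<le> (2 * real CARD('n) + 9) * (a + s) ^ 3"
  proof -
    have A: "a\<^sup>2 \<le> (a + s) ^ 3" "s\<^sup>2 \<le> (a + s) ^ 3" "a ^ 3 \<le> (a + s) ^ 3"
      using order_trans[OF power_mono[of a "a + s" 2] power_increasing[of 2 3 "a + s"]]
        order_trans[OF power_mono[of s "a + s" 2] power_increasing[of 2 3 "a + s"]]
        power_mono[of a "a + s" 3] a s by simp_all
    have "(8 * (norm x)\<^sup>2) * a ^ 3 \<le> 8 * a ^ 3" using x2 m a by (intro mult_right_mono) auto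
    moreover have "2 * real CARD('n) * a\<^sup>2 \<le> 2 * real CARD('n) * (a + s) ^ 3" using A by (intro mult_left_mono) auto
    ultimately show ?thesis using A unfolding hZ_def distrib_right by linarith
  qed
  then have "L * r * (hZ + s\<^sup>2) \<le> L * r * ((2 * real CARD('n) + 9) * (a + s) ^ 3)"
    using L1 by (intro mult_left_mono) (auto simp: r_def)
  moreover have "(norm gx)\<^sup>2 - (L * (a + s))\<^sup>2 - exp ((p - 1) * w x t) * norm gx powr p
      + exp ((p - 1) * w y t) * (L * (a + s)) powr p < - (L * r * ((2 * real CARD('n) + 9) * (a + s) ^ 3))"
  proof (rule doubling_arith[OF p _ _ b _ refl D])
    show "\<bar>norm gx - L * (a + s)\<bar> \<le> D"
      using norm_triangle_ineq3[of gx gy] by (simp add: gx_eq D_def gyn)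
  qed (use a s r \<eta> Lrb \<Phi> \<delta> L bnd[of y t] y t m in auto)
  ultimately show False using X(3) Y(3) hxy tau unfolding gyn by (simp add: algebra_simps)
qed

text \<open>Taking \<open>M = B + 1\<close> in the logarithm keeps \<open>M - u\<close> between 1
  and \<open>2 * B + 1\<close>, so the transformed function is nonnegative and bounded.
  \<open>L\<close> is fixed before \<open>u\<close>, so that one constant serves all rescalings of a
  solution.\<close>

lemma gradient_bound_unit:
  assumes p: "p > 2" and B: "B \<ge> 0"
  obtains L where "L \<ge> 0" "\<And>(u :: real^'n \<Rightarrow> real \<Rightarrow> real) g h.
    (\<And>x t. norm x \<le> 2 \<Longrightarrow> -1 \<le> t \<Longrightarrow> t \<le> 0 \<Longrightarrow> sol_at p u x t \<and> \<bar>u x t\<bar> \<le> B) \<Longrightarrow>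
    continuous_on (cball 0 2 \<times> {-1..0}) (\<lambda>(x,t). u x t) \<Longrightarrow>
    grad_lap (\<lambda>x. u x 0) 0 g h \<Longrightarrow> norm g \<le> L"
proof
  define b where "b = ln (2 * B + 1)"
  define L where "L = 2 * real CARD('n) + 30 + 4 * p + 4 * p * b + 4 * b"
  have b: "b \<ge> 0" using B by (simp add: b_def)
  have "L \<ge> 0" using p b by (simp add: L_def)
  then show "2 * L * (2 * B + 1) \<ge> 0" using B by simp
  fix u :: "real^'n \<Rightarrow> real \<Rightarrow> real" and g h
  assume u: "\<And>x t. norm x \<le> 2 \<Longrightarrow> -1 \<le> t \<Longrightarrow> t \<le> 0 \<Longrightarrow> sol_at p u x t \<and> \<bar>u x t\<bar> \<le> B"
    and c: "continuous_on (cball 0 2 \<times> {-1..0}) (\<lambda>(x,t). u x t)"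
    and g: "grad_lap (\<lambda>x. u x 0) 0 g h"
  define w where "w = (\<lambda>x t. ln (B + 1 - u x t))"
  have ub: "1 \<le> B + 1 - u x t" "B + 1 - u x t \<le> 2 * B + 1" if "norm x \<le> 2" "-1 \<le> t" "t \<le> 0" for x t
    using u[OF that] by linarith+
  have wl: "w 0 0 - w y 0 \<le> 2 * L * norm y" if "norm y \<le> 2" for y
  proof (rule log_sol_lipschitz_at_origin[OF p b _ _ _ _ that])
    fix x :: "real^'n" and t :: real
    assume xt: "norm x \<le> 2" "-1 \<le> t" "t \<le> 0"
    show "log_sol_at p w x t" unfolding w_def
      by (rule log_sol_at_ln) (use u[OF xt] in auto)
    show "0 \<le> w x t \<and> w x t \<le> b" unfolding w_def b_def using ub[OF xt] by simp
  next
    have "B + 1 - (case z of (x, t) \<Rightarrow> u x t) \<noteq> 0" if "z \<in> cball 0 2 \<times> {-1..0}" for z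
      using that ub[of "fst z" "snd z"] by (auto simp: case_prod_unfold)
    then have "continuous_on (cball 0 2 \<times> {-1..0}) (\<lambda>z. ln (B + 1 - (case z of (x, t) \<Rightarrow> u x t)))"
      by (intro continuous_intros c) auto
    then show "continuous_on (cball 0 2 \<times> {-1..0}) (\<lambda>(x, t). w x t)"
      by (simp add: w_def case_prod_unfold)
  qed (simp add: L_def)
  define V where "V = B + 1 - u 0 0"
  have V: "1 \<le> V" "V \<le> 2 * B + 1" using ub[of 0 0] by (simp_all add: V_def)
  have gw: "grad_lap (\<lambda>x. w x 0) 0 (- (1 / V) *\<^sub>R g) (- (h / V) - (norm g)\<^sup>2 / V\<^sup>2)"
    unfolding w_def V_def using V by (intro grad_lap_ln_diff g) (simp add: V_def)
  have "norm ((1 / V) *\<^sub>R g) \<le> 2 * L"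
  proof (cases "g = 0")
    case False
    \<comment> \<open>The doubling estimate limits only the decrease of \<open>w\<close> away from
      the origin. As the gradient of \<open>w\<close> is a negative multiple of \<open>g\<close>,
      the direction of \<open>g\<close> is that of steepest decrease, and the one-sided bound
      controls the whole norm.\<close>
    define e where "e = (1 / norm g) *\<^sub>R g"
    have e: "norm e = 1" using False by (simp add: e_def)
    have "((\<lambda>s. s *\<^sub>R e) has_derivative (\<lambda>v. v *\<^sub>R e)) (at 0)" by (auto intro!: derivative_eq_intros)
    moreover have "((\<lambda>x. w x 0) has_derivative (\<lambda>v. (- (1 / V) *\<^sub>R g) \<bullet> v)) (at (0 *\<^sub>R e))"
      using grad_lap_has_derivative[OF gw] by (simp only: scaleR_zero_left)
    ultimately have "((\<lambda>s. w (s *\<^sub>R e) 0) has_derivative (\<lambda>v. (- (1 / V) *\<^sub>R g) \<bullet> (v *\<^sub>R e))) (at 0)"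
      by (rule has_derivative_compose)
    then have "((\<lambda>s. w (s *\<^sub>R e) 0) has_real_derivative - (g \<bullet> e) / V) (at 0)"
      unfolding has_field_derivative_def
      by (rule has_derivative_eq_rhs) (auto simp: fun_eq_iff)
    then have d: "((\<lambda>s. w 0 0 - w (s *\<^sub>R e) 0 - 2 * L * s) has_real_derivative (g \<bullet> e) / V - 2 * L) (at 0)"
      by (auto intro!: derivative_eq_intros)
    have "(g \<bullet> e) / V - 2 * L \<le> 0"
    proof (rule ccontr)
      assume "\<not> (g \<bullet> e) / V - 2 * L \<le> 0"
      with DERIV_pos_inc_right[OF d] obtain d where d: "d > 0"
        "\<And>h. 0 < h \<Longrightarrow> h < d \<Longrightarrow> 0 < w 0 0 - w (h *\<^sub>R e) 0 - 2 * L * h" by (auto simp: not_le)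
      define h where "h = min 1 (d / 2)"
      have h: "0 < h" "h < d" "h \<le> 1" using d(1) by (auto simp: h_def)
      from d(2)[OF h(1,2)] wl[of "h *\<^sub>R e"] h e show False by simp
    qed
    moreover have "g \<bullet> e = norm g" using False by (simp add: e_def dot_square_norm power2_eq_square)
    ultimately show ?thesis using V by simp
  qed (use \<open>L \<ge> 0\<close> in simp)
  then have "norm g \<le> 2 * L * V" using V by (simp add: field_simps)
  also have "\<dots> \<le> 2 * L * (2 * B + 1)" using V \<open>L \<ge> 0\<close> by (intro mult_left_mono) auto
  finally show "norm g \<le> 2 * L * (2 * B + 1)" .
qed

section \<open>Decay of increments and comparison on strips\<close>

text \<open>For two solutions with gradients bounded by \<open>M\<close>, the factor
  \<open>p * M powr (p - 1)\<close> becomes the drift bound in the inequality for their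
  difference.\<close>

lemma powr_diff_le:
  fixes a b M p :: real
  assumes "0 \<le> a" "0 \<le> b" "a \<le> M" "p \<ge> 1"
  shows "a powr p - b powr p \<le> p * M powr (p - 1) * \<bar>a - b\<bar>"
proof (cases "a \<le> b")
  case True
  then have "a powr p \<le> b powr p" using assms by (intro powr_mono2) auto
  moreover have "0 \<le> p * M powr (p - 1) * \<bar>a - b\<bar>" using assms by simp
  ultimately show ?thesis by linarith
next
  case False
  then have a: "a > 0" using assms by simp
  define x where "x = (a - b) / a"
  have x: "0 \<le> x" "x \<le> 1" "b = a * (1 - x)" using a False assms by (simp_all add: x_def field_simps)
  have "a powr p * (1 - p * x) \<le> a powr p * (1 - x) powr p"
    using one_minus_powr_ge[OF x(1,2)] assms by (intro mult_left_mono) auto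
  also have "\<dots> = b powr p" unfolding x(3) using a x by (intro powr_mult[symmetric])
  finally have "a powr p - b powr p \<le> p * (a powr p * x)" by (simp add: algebra_simps)
  also have "a powr p * x = a powr (p - 1) * (a - b)" using a by (simp add: x_def powr_diff)
  also have "\<dots> \<le> M powr (p - 1) * (a - b)"
    using assms a False by (intro mult_right_mono powr_mono2) auto
  finally show ?thesis using False assms by (simp add: mult_left_mono mult.assoc)
qed

lemma grad_bound_lipschitz:
  fixes f :: "real^'n \<Rightarrow> real"
  assumes "convex S" "\<And>y. y \<in> S \<Longrightarrow> \<exists>g h. grad_lap f y g h \<and> norm g \<le> G" "x \<in> S" "y \<in> S"
  shows "\<bar>f x - f y\<bar> \<le> G * norm (x - y)"
proof -
  from assms(2) obtain g h where g: "\<And>y. y \<in> S \<Longrightarrow> grad_lap f y (g y) (h y) \<and> norm (g y) \<le> G"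
    by metis
  have "norm (f x - f y) \<le> G * norm (x - y)"
  proof (rule differentiable_bound[OF assms(1) _ _ assms(3,4)])
    fix z assume z: "z \<in> S"
    show "(f has_derivative (\<lambda>v. g z \<bullet> v)) (at z within S)"
      using g[OF z] grad_lap_has_derivative has_derivative_at_withinI by blast
    show "onorm (\<lambda>v. g z \<bullet> v) \<le> G"
    proof (rule onorm_le)
      fix v
      have "norm (g z \<bullet> v) \<le> norm (g z) * norm v" by (simp add: Cauchy_Schwarz_ineq2)
      also have "\<dots> \<le> G * norm v" using g[OF z] by (intro mult_right_mono) auto
      finally show "norm (g z \<bullet> v) \<le> G * norm v" .
    qed
  qed
  then show ?thesis by simp
qed

text \<open>Only the combination \<open>\<tau> - h\<close> is controlled, not the time derivative by
  itself. Subtracting \<open>G * (norm (y - x))\<^sup>2\<close> stands in for a bound on the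
  Laplacian: a maximum after the initial time would give \<open>h \<le> 2 * n * G\<close>, with n
  the dimension, against the time slope \<open>2 * n * G + N\<close>. Radius 2 suffices because 2 G
  < 4 G excludes the lateral boundary; returning from \<open>y\<close> to \<open>x\<close> costs at
  most \<open>G\<close>.\<close>

lemma time_increment_bound:
  fixes f :: "real^'n \<Rightarrow> real \<Rightarrow> real"
  assumes G: "G > 0" and \<sigma>: "\<sigma> \<ge> 0"
    and f: "\<And>y s. norm (y - x) \<le> 2 \<Longrightarrow> t \<le> s \<Longrightarrow> s \<le> t + \<sigma> \<Longrightarrow>
      \<exists>g h \<tau>. grad_lap (\<lambda>y. f y s) y g h \<and> (f y has_real_derivative \<tau>) (at s)
        \<and> norm g \<le> G \<and> \<tau> - h < N"
    and cont: "continuous_on (cball x 2 \<times> {t..t + \<sigma>}) (\<lambda>(y, s). f y s)"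
  shows "f x (t + \<sigma>) \<le> f x t + G + (2 * real CARD('n) * G + N) * \<sigma>"
proof -
  have lip: "f y s \<le> f x s + G * norm (y - x)"
    if "norm (y - x) \<le> 2" "t \<le> s" "s \<le> t + \<sigma>" for y s
  proof -
    have "\<bar>f y s - f x s\<bar> \<le> G * norm (y - x)"
    proof (rule grad_bound_lipschitz[of "cball x 2"])
      fix v assume "v \<in> cball x 2"
      then have "norm (v - x) \<le> 2" by (simp add: dist_norm norm_minus_commute)
      from f[OF this that(2,3)] show "\<exists>g h. grad_lap (\<lambda>a. f a s) v g h \<and> norm g \<le> G" by blast
    qed (use that in \<open>auto simp: dist_norm norm_minus_commute\<close>)
    then show ?thesis by linarith
  qed
  define F where "F = (\<lambda>(y, s). f y s - G * (norm (y - x))\<^sup>2 - (2 * real CARD('n) * G + N) * (s - t))"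
  let ?K = "cball x 2 \<times> {t..t + \<sigma>}"
  have "compact ?K" by (intro compact_Times compact_cball compact_Icc)
  moreover have "?K \<noteq> {}" using \<sigma> by auto
  moreover have "continuous_on ?K F" unfolding F_def case_prod_unfold
    by (intro continuous_intros cont[unfolded case_prod_unfold])
  ultimately obtain z where z: "z \<in> ?K" "\<And>z'. z' \<in> ?K \<Longrightarrow> F z' \<le> F z"
    using continuous_attains_sup[of ?K F] by blast
  obtain y s where ys: "z = (y, s)" by (cases z)
  have y: "norm (y - x) \<le> 2" and s: "t \<le> s" "s \<le> t + \<sigma>"
    using z(1) by (auto simp: ys dist_norm norm_minus_commute)
  have y2: "norm (y - x) < 2"
  proof (rule ccontr)
    assume "\<not> norm (y - x) < 2"
    then have e: "norm (y - x) = 2" using y by simp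
    have "F (x, s) \<le> F (y, s)" using z(2)[of "(x, s)"] s by (simp add: ys)
    then show False using lip[OF y s] G unfolding F_def by (simp add: e)
  qed
  have "s = t"
  proof (rule ccontr)
    assume "s \<noteq> t"
    then have st: "t < s" using s by simp
    obtain g h \<tau> where j: "grad_lap (\<lambda>y. f y s) y g h" "(f y has_real_derivative \<tau>) (at s)" "\<tau> - h < N"
      using f[OF y s] by blast
    have "\<forall>\<^sub>F v in nhds y. v \<in> ball x 2"
      using y2 by (intro eventually_nhds_in_open) (auto simp: dist_norm norm_minus_commute)
    then have "\<forall>\<^sub>F v in nhds y. f v s - G * (norm (v - x))\<^sup>2 \<le> f y s - G * (norm (y - x))\<^sup>2"
    proof eventually_elim
      case (elim v)
      then show ?case using z(2)[of "(v, s)"] s by (simp add: ys F_def)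
    qed
    from grad_lap_local_max(2)[OF grad_lap_diff[OF j(1) grad_lap_cmult[OF grad_lap_norm_sq]] this]
    have "h \<le> 2 * real CARD('n) * G" by (simp add: mult.commute)
    moreover have "0 \<le> \<tau> - (2 * real CARD('n) * G + N)"
    proof (rule deriv_left_max_nonneg)
      show "((\<lambda>s. f y s - (2 * real CARD('n) * G + N) * s) has_real_derivative \<tau> - (2 * real CARD('n) * G + N)) (at s)"
        by (auto intro!: derivative_eq_intros j(2))
      fix v assume "s - (s - t) < v" "v < s"
      then show "f y v - (2 * real CARD('n) * G + N) * v \<le> f y s - (2 * real CARD('n) * G + N) * s"
        using z(2)[of "(y, v)"] s y by (simp add: ys F_def dist_norm norm_minus_commute right_diff_distrib)
    qed (use st in simp)
    ultimately show False using j(3) by linarith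
  qed
  have "F (x, t + \<sigma>) \<le> F (y, t)" using z(2)[of "(x, t + \<sigma>)"] \<sigma> by (simp add: ys \<open>s = t\<close>)
  then have "f x (t + \<sigma>) \<le> f x t + G * (norm (y - x) - (norm (y - x))\<^sup>2) + (2 * real CARD('n) * G + N) * \<sigma>"
    using lip[OF y, of t] \<sigma> by (simp add: F_def algebra_simps)
  also have "G * (norm (y - x) - (norm (y - x))\<^sup>2) \<le> G * 1"
  proof (rule mult_left_mono)
    have "0 \<le> (norm (y - x) - 1 / 2)\<^sup>2" by simp
    then show "norm (y - x) - (norm (y - x))\<^sup>2 \<le> 1" by (simp add: power2_eq_square algebra_simps)
  qed (use G in simp)
  finally show ?thesis by simp
qed

section \<open>Comparison on strips with bounded drift\<close>

lemma grad_lap_exp_component: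
  fixes x :: "real^'n"
  shows "grad_lap (\<lambda>x. exp (\<kappa> * x $ k)) x ((\<kappa> * exp (\<kappa> * x $ k)) *\<^sub>R axis k 1) (\<kappa>\<^sup>2 * exp (\<kappa> * x $ k))"
proof -
  have "\<forall>\<^sub>F s in nhds (x $ k). ((\<lambda>s. exp (\<kappa> * s)) has_real_derivative \<kappa> * exp (\<kappa> * s)) (at s)"
    by (intro always_eventually allI) (auto intro!: derivative_eq_intros)
  moreover have "((\<lambda>s. \<kappa> * exp (\<kappa> * s)) has_real_derivative \<kappa>\<^sup>2 * exp (\<kappa> * x $ k)) (at (x $ k))"
    by (auto intro!: derivative_eq_intros simp: power2_eq_square)
  ultimately show ?thesis using grad_lap_compose[OF grad_lap_component] by fastforce
qed

text \<open>The quadratic penalty localises in the unbounded directions, time included, so that no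
  initial condition is needed; \<open>exp (\<kappa> * x $ k)\<close> supplies the strict inequality.\<close>

lemma strip_maximum_principle:
  fixes z :: "real^'n \<Rightarrow> real \<Rightarrow> real" and k :: 'n and \<epsilon> \<Lambda> :: real
  defines "S \<equiv> {x. \<epsilon> \<le> x $ k \<and> x $ k \<le> \<Lambda>}"
  assumes \<epsilon>: "\<epsilon> \<ge> 0" and N: "N \<ge> 0" and \<delta>: "\<delta> > 0"
    and cont: "continuous_on (S \<times> UNIV) (\<lambda>(x, t). z x t)"
    and bnd: "\<And>x t. x \<in> S \<Longrightarrow> z x t \<le> B"
    and edge: "\<And>x t. x \<in> S \<Longrightarrow> x $ k = \<epsilon> \<or> x $ k = \<Lambda> \<Longrightarrow> z x t \<le> \<delta>"
    and eq: "\<And>x t. \<epsilon> < x $ k \<Longrightarrow> x $ k < \<Lambda> \<Longrightarrow> \<exists>g h \<tau>. grad_lap (\<lambda>y. z y t) x g h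
      \<and> (z x has_real_derivative \<tau>) (at t) \<and> \<tau> - h \<le> N * norm g"
    and x0: "x0 \<in> S"
  shows "z x0 t0 \<le> 2 * \<delta>"
proof (rule ccontr)
  assume z0: "\<not> z x0 t0 \<le> 2 * \<delta>"
  \<comment> \<open>This value gives \<open>\<kappa>\<^sup>2 - N * \<kappa> = \<kappa>\<close>, so
    the exponential leaves a surplus of at least \<open>c * \<kappa>\<close> over the drift;
    \<open>c\<close> is normalised so that the exponential term is at most \<delta> on the
    strip.\<close>
  define \<kappa> where "\<kappa> = N + 1"
  define c where "c = \<delta> * exp (- (\<kappa> * \<Lambda>))"
  define n where "n = real CARD('n)"
  \<comment> \<open>Two demands are separated by \<open>\<eta> = \<theta>\<^sup>2\<close> and
    \<open>\<rho> = s / \<theta>\<close>. The penalty reaches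
    \<open>\<eta> * \<rho>\<^sup>2 = s\<^sup>2\<close>, beyond \<open>B + \<delta>\<close>, at
    distance \<rho>, while its derivatives are of order \<open>\<theta> * s\<close> and \<eta>.
    \<open>A * \<theta>\<close> collects these errors and must stay below the surplus.\<close>
  define s where "s = sqrt (\<bar>B\<bar> + \<delta> + 1)"
  define A where "A = 2 * (1 + N) * s + 2 * n"
  define \<theta> where "\<theta> = min 1 (c * \<kappa> / (A + 1) / 2)"
  define \<eta> where "\<eta> = \<theta>\<^sup>2"
  define \<rho> where "\<rho> = s / \<theta>"
  have \<kappa>: "\<kappa> > 0" using N by (simp add: \<kappa>_def)
  have c: "c > 0" using \<delta> by (simp add: c_def)
  have s: "s > 0" "s\<^sup>2 = \<bar>B\<bar> + \<delta> + 1" using \<delta> by (simp_all add: s_def)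
  have A: "A > 0" using s N by (simp add: A_def n_def add_pos_nonneg)
  have \<theta>: "0 < \<theta>" "\<theta> \<le> 1" "\<theta> \<le> c * \<kappa> / (A + 1) / 2"
    using c \<kappa> A min.cobounded2[of 1 "c * \<kappa> / (A + 1) / 2"] unfolding \<theta>_def by simp_all
  have A\<theta>: "A * \<theta> < c * \<kappa>"
  proof -
    have "(A + 1) * \<theta> \<le> c * \<kappa> / 2" using \<theta>(3) A by (simp add: field_simps)
    moreover have "0 < c * \<kappa>" using c \<kappa> by simp
    ultimately show ?thesis using \<theta>(1) by (simp add: distrib_right)
  qed
  have \<eta>: "\<eta> > 0" "\<eta> * \<rho> = \<theta> * s" "\<eta> * \<rho>\<^sup>2 = s\<^sup>2" "\<eta> \<le> \<theta>"
    using \<theta> by (simp_all add: \<eta>_def \<rho>_def power2_eq_square mult_left_le)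
  have \<rho>: "\<rho> > 0" using s \<theta> by (simp add: \<rho>_def)
  define f where "f = (\<lambda>(x, t). z x t + c * exp (\<kappa> * x $ k) - \<eta> * ((norm (x - x0))\<^sup>2 + (t - t0)\<^sup>2))"
  have ce: "c * exp (\<kappa> * x $ k) \<le> \<delta>" if "x \<in> S" for x
  proof -
    have "exp (\<kappa> * x $ k) \<le> exp (\<kappa> * \<Lambda>)" using that \<kappa> by (simp add: S_def)
    then have "c * exp (\<kappa> * x $ k) \<le> c * exp (\<kappa> * \<Lambda>)" using c by simp
    also have "\<dots> = \<delta>" by (simp add: c_def exp_minus)
    finally show ?thesis .
  qed
  define K where "K = (S \<inter> cball x0 \<rho>) \<times> {t0 - \<rho>..t0 + \<rho>}"
  have "closed S" unfolding S_def
    by (intro closed_Collect_conj closed_Collect_le continuous_intros)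
  then have "compact K" unfolding K_def
    by (intro compact_Times closed_Int_compact compact_cball compact_Icc)
  moreover have K0: "(x0, t0) \<in> K" using x0 \<rho> by (simp add: K_def)
  moreover have "continuous_on K f"
  proof -
    have "continuous_on K (\<lambda>w. (\<lambda>(x, t). z x t) (fst w, snd w))"
      by (rule continuous_on_compose2[OF cont], intro continuous_intros) (auto simp: K_def)
    then show ?thesis unfolding f_def case_prod_unfold by (intro continuous_intros) auto
  qed
  ultimately obtain w where w: "w \<in> K" "\<And>w'. w' \<in> K \<Longrightarrow> f w' \<le> f w"
    using continuous_attains_sup[of K f] by blast
  obtain x t where xt: "w = (x, t)" by (cases w)
  have x: "x \<in> S" "norm (x - x0) \<le> \<rho>" and t: "\<bar>t - t0\<bar> \<le> \<rho>"
    using w(1) by (auto simp: K_def xt dist_norm norm_minus_commute)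
  have "f (x0, t0) \<le> f (x, t)" using w(2)[OF K0] by (simp add: xt)
  moreover have "0 < c * exp (\<kappa> * x0 $ k)" using c by simp
  ultimately have fx: "2 * \<delta> < f (x, t)" using z0 by (simp add: f_def)
  have far: "(norm (x - x0))\<^sup>2 + (t - t0)\<^sup>2 < \<rho>\<^sup>2"
  proof (rule ccontr)
    assume "\<not> ?thesis"
    then have "\<eta> * \<rho>\<^sup>2 \<le> \<eta> * ((norm (x - x0))\<^sup>2 + (t - t0)\<^sup>2)" using \<eta> by (intro mult_left_mono) auto
    then show False using fx bnd[OF x(1), of t] ce[OF x(1)] \<eta>(3) s \<delta> by (simp add: f_def)
  qed
  have x2: "norm (x - x0) < \<rho>"
  proof -
    have "(norm (x - x0))\<^sup>2 < \<rho>\<^sup>2" using far zero_le_power2[of "t - t0"] by linarith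
    then show ?thesis using \<rho> by (simp add: power2_less_imp_less)
  qed
  have t2: "\<bar>t - t0\<bar> < \<rho>"
  proof -
    have "\<bar>t - t0\<bar>\<^sup>2 < \<rho>\<^sup>2" using far zero_le_power2[of "norm (x - x0)"] unfolding power2_abs by linarith
    then show ?thesis using \<rho> by (metis power2_less_imp_less less_imp_le)
  qed
  have pen: "0 \<le> \<eta> * ((norm (x - x0))\<^sup>2 + (t - t0)\<^sup>2)" using \<eta> by simp
  have ins: "\<epsilon> < x $ k" "x $ k < \<Lambda>"
  proof -
    have "x $ k \<noteq> \<epsilon> \<and> x $ k \<noteq> \<Lambda>"
      using fx edge[OF x(1), of t] ce[OF x(1)] pen by (auto simp: f_def)
    then show "\<epsilon> < x $ k" "x $ k < \<Lambda>" using x(1) by (auto simp: S_def)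
  qed
  obtain g h \<tau> where j: "grad_lap (\<lambda>y. z y t) x g h" "(z x has_real_derivative \<tau>) (at t)" "\<tau> - h \<le> N * norm g"
    using eq[OF ins] by blast
  define E where "E = exp (\<kappa> * x $ k)"
  have E: "E \<ge> 1" using ins \<epsilon> \<kappa> by (simp add: E_def)
  have "open {y. norm (y - x0) < \<rho> \<and> \<epsilon> < y $ k \<and> y $ k < \<Lambda>}"
    by (intro open_Collect_conj open_Collect_less continuous_intros)
  from eventually_nhds_in_open[OF this, of x]
  have "\<forall>\<^sub>F y in nhds x. norm (y - x0) < \<rho> \<and> \<epsilon> < y $ k \<and> y $ k < \<Lambda>" using x2 ins by simp
  then have "\<forall>\<^sub>F y in nhds x. z y t + c * exp (\<kappa> * y $ k) - \<eta> * (norm (y - x0))\<^sup>2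
      \<le> z x t + c * exp (\<kappa> * x $ k) - \<eta> * (norm (x - x0))\<^sup>2"
  proof eventually_elim
    case (elim y)
    then have "(y, t) \<in> K" using t by (auto simp: K_def S_def dist_norm norm_minus_commute)
    from w(2)[OF this] show ?case by (simp add: f_def xt algebra_simps)
  qed
  note mx = grad_lap_local_max[OF grad_lap_diff[OF grad_lap_add[OF j(1) grad_lap_cmult[OF grad_lap_exp_component]]
        grad_lap_cmult[OF grad_lap_norm_sq]] this, folded E_def]
  have "g = \<eta> *\<^sub>R (2 *\<^sub>R (x - x0)) - c *\<^sub>R ((\<kappa> * E) *\<^sub>R axis k 1)"
    using mx(1) by (simp add: algebra_simps)
  then have "norm g \<le> norm (\<eta> *\<^sub>R (2 *\<^sub>R (x - x0))) + norm (c *\<^sub>R ((\<kappa> * E) *\<^sub>R (axis k 1 :: real^'n)))"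
    by (simp only: norm_triangle_ineq4)
  also have "\<dots> = 2 * (\<eta> * norm (x - x0)) + c * \<kappa> * E" using \<eta> c \<kappa> E by simp
  also have "\<eta> * norm (x - x0) \<le> \<eta> * \<rho>" using x2 \<eta> by (intro mult_left_mono) auto
  finally have "norm g \<le> 2 * (\<theta> * s) + c * \<kappa> * E" by (simp add: \<eta>(2))
  then have "N * norm g \<le> N * (2 * (\<theta> * s) + c * \<kappa> * E)" using N by (rule mult_left_mono)
  moreover have "h \<le> 2 * n * \<eta> - c * \<kappa>\<^sup>2 * E" using mx(2) by (simp add: n_def mult_ac)
  moreover have "0 \<le> \<tau> - \<eta> * (2 * (t - t0))"
  proof (rule deriv_left_max_nonneg)
    show "((\<lambda>v. z x v - \<eta> * (v - t0)\<^sup>2) has_real_derivative \<tau> - \<eta> * (2 * (t - t0))) (at t)"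
      by (auto intro!: derivative_eq_intros j(2))
    fix v assume v: "t - (t - (t0 - \<rho>)) < v" "v < t"
    then have "(x, v) \<in> K" using t x by (auto simp: K_def dist_norm norm_minus_commute)
    from w(2)[OF this] show "z x v - \<eta> * (v - t0)\<^sup>2 \<le> z x t - \<eta> * (t - t0)\<^sup>2"
      by (simp add: f_def xt algebra_simps)
  qed (use t2 in auto)
  moreover have "\<eta> * (2 * (t0 - t)) \<le> \<eta> * (2 * \<rho>)" using \<eta> t by (intro mult_left_mono) auto
  moreover have "2 * n * \<eta> \<le> 2 * n * \<theta>" using \<eta> by (intro mult_left_mono) (auto simp: n_def)
  moreover have "c * \<kappa>\<^sup>2 * E = N * (c * \<kappa> * E) + c * \<kappa> * E"
    by (simp add: \<kappa>_def power2_eq_square algebra_simps)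
  moreover have "c * \<kappa> * 1 \<le> c * \<kappa> * E" using c \<kappa> E by (intro mult_left_mono) auto
  moreover have "A * \<theta> = 2 * (\<theta> * s) + N * (2 * (\<theta> * s)) + 2 * n * \<theta>"
    by (simp add: A_def algebra_simps)
  ultimately show False using j(3) A\<theta> \<eta>(2) by (simp add: algebra_simps)
qed

section \<open>Decay and translation invariance on the half-space\<close>

context half_space_solution
begin

lemma rescaled_point_height:
  assumes "R > 0" "x $ k = 4 * R" "norm \<xi> \<le> 2"
  shows "2 * R \<le> (x + R *\<^sub>R \<xi>) $ k" "(x + R *\<^sub>R \<xi>) $ k \<le> 6 * R"
proof -
  have "\<bar>\<xi> $ k\<bar> \<le> 2" using component_le_norm_cart[of \<xi> k] assms by linarith
  then have "R * \<bar>\<xi> $ k\<bar> \<le> R * 2" using assms by (intro mult_left_mono) auto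
  then have "\<bar>R * \<xi> $ k\<bar> \<le> R * 2" using assms by (simp add: abs_mult)
  then show "2 * R \<le> (x + R *\<^sub>R \<xi>) $ k" "(x + R *\<^sub>R \<xi>) $ k \<le> 6 * R" using assms by (simp_all add: abs_le_iff)
qed

text \<open>Rescaling by a quarter of the height puts the unit-scale cylinder at heights between 2 R
  and 6 R, where the growth bound turns into the fixed bound \<open>B\<close>. Undoing the scaling
  gives the exponent \<alpha> - 1 = -1 / (p - 1).\<close>

lemma gradient_bound:
  obtains L where "L \<ge> 0" "\<And>x t g h. x $ k > 0 \<Longrightarrow> grad_lap (\<lambda>y. u y t) x g h \<Longrightarrow>
    norm g \<le> L * (x $ k / 4) powr (- (1 / (p - 1)))"
proof -
  define B where "B = growth_const * 6 powr \<alpha>"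
  have B: "B \<ge> 0" using growth_const_nonneg by (simp add: B_def)
  obtain L where L: "L \<ge> 0" "\<And>(v :: real^'n \<Rightarrow> real \<Rightarrow> real) g h.
    (\<And>x t. norm x \<le> 2 \<Longrightarrow> -1 \<le> t \<Longrightarrow> t \<le> 0 \<Longrightarrow> sol_at p v x t \<and> \<bar>v x t\<bar> \<le> B) \<Longrightarrow>
    continuous_on (cball 0 2 \<times> {-1..0}) (\<lambda>(x,t). v x t) \<Longrightarrow>
    grad_lap (\<lambda>x. v x 0) 0 g h \<Longrightarrow> norm g \<le> L"
    using gradient_bound_unit[OF p B] by blast
  show ?thesis
  proof
    fix x t g h
    assume x: "x $ k > 0" and g: "grad_lap (\<lambda>y. u y t) x g h"
    define R where "R = x $ k / 4"
    have R: "R > 0" "x $ k = 4 * R" using x by (simp_all add: R_def)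
    note height = rescaled_point_height[OF R]
    define c where "c = R powr (- \<alpha>)"
    have c: "c > 0" using R by (simp add: c_def)
    define v where "v = (\<lambda>\<xi> s. c * u (x + R *\<^sub>R \<xi>) (t + R\<^sup>2 * s))"
    have "norm (c *\<^sub>R (R *\<^sub>R g)) \<le> L"
    proof (rule L(2)[of v])
      fix \<xi> :: "real^'n" and s :: real
      assume \<xi>: "norm \<xi> \<le> 2" "-1 \<le> s" "s \<le> 0"
      have pos: "(x + R *\<^sub>R \<xi>) $ k > 0" using height(1)[OF \<xi>(1)] R by linarith
      have "sol_at p v \<xi> s" unfolding v_def c_def
        by (rule sol_at_rescale[OF sol[OF pos]]) (use R p in auto)
      moreover have "\<bar>v \<xi> s\<bar> \<le> B"
      proof -
        have "\<bar>v \<xi> s\<bar> = c * \<bar>u (x + R *\<^sub>R \<xi>) (t + R\<^sup>2 * s)\<bar>" using c by (simp add: v_def abs_mult)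
        also have "\<dots> \<le> c * (growth_const * ((x + R *\<^sub>R \<xi>) $ k) powr \<alpha>)"
          using c by (intro mult_left_mono abs_le_growth pos) auto
        also have "\<dots> \<le> c * (growth_const * (6 * R) powr \<alpha>)"
          using c pos height(2)[OF \<xi>(1)] p growth_const_nonneg by (intro mult_left_mono powr_mono2) auto
        also have "(6 * R) powr \<alpha> = 6 powr \<alpha> * R powr \<alpha>" using R by (simp add: powr_mult)
        also have "c * (growth_const * (6 powr \<alpha> * R powr \<alpha>)) = B * (c * R powr \<alpha>)" by (simp add: B_def)
        also have "c * R powr \<alpha> = 1" using R by (simp add: c_def powr_minus)
        finally show ?thesis by simp
      qed
      ultimately show "sol_at p v \<xi> s \<and> \<bar>v \<xi> s\<bar> \<le> B" ..
    next
      show "continuous_on (cball 0 2 \<times> {-1..0}) (\<lambda>(\<xi>, s). v \<xi> s)"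
        unfolding v_def
      proof (rule continuous_on_rescale[OF cont])
        fix \<xi> :: "real^'n" and s :: real assume "(\<xi>, s) \<in> cball 0 2 \<times> {-1..0}"
        then show "(x + R *\<^sub>R \<xi>, t + R\<^sup>2 * s) \<in> {x. 0 \<le> x $ k} \<times> UNIV"
          using height(1)[of \<xi>] R by auto
      qed
    next
      have "grad_lap (\<lambda>y. u y t) (x + R *\<^sub>R 0) g h" using g by simp
      from grad_lap_cmult[OF grad_lap_affine[OF this], of c]
      show "grad_lap (\<lambda>\<xi>. v \<xi> 0) 0 (c *\<^sub>R (R *\<^sub>R g)) (c * (R\<^sup>2 * h))" by (simp add: v_def)
    qed
    then have "(c * R) * norm g \<le> L" using c R by (simp add: mult_ac)
    moreover have "c * R = R powr (1 / (p - 1))"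
    proof -
      have "c * R = R powr (- \<alpha> + 1)" using R powr_add[of R "- \<alpha>" 1] by (simp add: c_def)
      also have "- \<alpha> + 1 = 1 / (p - 1)" using p by (simp add: field_simps)
      finally show ?thesis .
    qed
    ultimately have "R powr (1 / (p - 1)) * norm g \<le> L" by simp
    then show "norm g \<le> L * (x $ k / 4) powr (- (1 / (p - 1)))"
      using R unfolding R_def[symmetric] by (simp add: powr_minus field_simps)
  qed (rule L(1))
qed

lemma gradient_bounded_above:
  assumes "\<epsilon> > 0"
  obtains M where "M \<ge> 0" "\<And>x t g h. x $ k \<ge> \<epsilon> \<Longrightarrow> grad_lap (\<lambda>y. u y t) x g h \<Longrightarrow> norm g \<le> M"
proof -
  from gradient_bound obtain L where L: "L \<ge> 0" "\<And>x t g h. x $ k > 0 \<Longrightarrow> grad_lap (\<lambda>y. u y t) x g h \<Longrightarrow>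
    norm g \<le> L * (x $ k / 4) powr (- (1 / (p - 1)))" by blast
  show ?thesis
  proof
    show "0 \<le> L * (\<epsilon> / 4) powr (- (1 / (p - 1)))" using L by simp
    fix x t g h assume x: "x $ k \<ge> \<epsilon>" and g: "grad_lap (\<lambda>y. u y t) x g h"
    have "norm g \<le> L * (x $ k / 4) powr (- (1 / (p - 1)))" using L(2)[OF _ g] x assms by simp
    also have "\<dots> \<le> L * (\<epsilon> / 4) powr (- (1 / (p - 1)))"
      using x assms p L by (intro mult_left_mono powr_mono2') auto
    finally show "norm g \<le> L * (\<epsilon> / 4) powr (- (1 / (p - 1)))" .
  qed
qed

lemma gradient_small:
  assumes "\<delta> > 0"
  obtains \<Lambda> where "\<Lambda> > 0" "\<And>x t g h. x $ k \<ge> \<Lambda> \<Longrightarrow> grad_lap (\<lambda>y. u y t) x g h \<Longrightarrow> norm g \<le> \<delta>"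
proof -
  from gradient_bound obtain L where L: "L \<ge> 0" "\<And>x t g h. x $ k > 0 \<Longrightarrow> grad_lap (\<lambda>y. u y t) x g h \<Longrightarrow>
    norm g \<le> L * (x $ k / 4) powr (- (1 / (p - 1)))" by blast
  \<comment> \<open>At height \<Lambda> the decaying power equals \<open>\<delta> / (L + 1)\<close>;
    \<open>L + 1\<close> keeps the base positive even for \<open>L = 0\<close>.\<close>
  define \<Lambda> where "\<Lambda> = 4 * ((L + 1) / \<delta>) powr (p - 1)"
  have \<Lambda>: "\<Lambda> > 0" using L assms by (simp add: \<Lambda>_def)
  show ?thesis
  proof
    show "\<Lambda> > 0" by (rule \<Lambda>)
    fix x t g h assume x: "x $ k \<ge> \<Lambda>" and g: "grad_lap (\<lambda>y. u y t) x g h"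
    have "norm g \<le> L * (x $ k / 4) powr (- (1 / (p - 1)))" using L(2)[OF _ g] x \<Lambda> by simp
    also have "\<dots> \<le> L * (\<Lambda> / 4) powr (- (1 / (p - 1)))"
      using x \<Lambda> p L by (intro mult_left_mono powr_mono2') auto
    also have "(\<Lambda> / 4) powr (- (1 / (p - 1))) = ((L + 1) / \<delta>) powr (- 1)"
      using p by (simp add: \<Lambda>_def powr_powr)
    also have "((L + 1) / \<delta>) powr (- 1) = \<delta> / (L + 1)"
      using L assms by (simp add: powr_minus)
    also have "L * (\<delta> / (L + 1)) = L / (L + 1) * \<delta>" by simp
    also have "\<dots> \<le> 1 * \<delta>" using L assms by (intro mult_right_mono) auto
    finally show "norm g \<le> \<delta>" by simp
  qed
qed

text \<open>High up the gradient is small, and hence so is the source \<open>norm g powr p\<close>.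
  The tangential increment follows by integration, the time increment from
  \<open>time_increment_bound\<close> for \<open>u\<close> and for \<open>- u\<close>.\<close>

lemma increment_small:
  assumes a: "a $ k = 0" and \<sigma>: "\<sigma> \<ge> 0" and \<delta>: "\<delta> > 0"
  obtains \<Lambda> where "\<Lambda> > 0" "\<And>x t. x $ k \<ge> \<Lambda> \<Longrightarrow> \<bar>u (x + a) (t + \<sigma>) - u x t\<bar> \<le> \<delta>"
proof -
  \<comment> \<open>The whole increment will be at most \<open>G * c\<close>. The bound
    \<open>G \<le> 1\<close> gives \<open>G powr p \<le> G\<close>, so the source is controlled by
    \<open>G\<close> as well.\<close>
  define c where "c = norm a + 1 + (2 * real CARD('n) + 2) * \<sigma>"
  have "0 \<le> (2 * real CARD('n) + 2) * \<sigma>" using \<sigma> by simp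
  then have c: "c > 0" unfolding c_def using norm_ge_zero[of a] by linarith
  define G where "G = min 1 (\<delta> / c)"
  have G: "0 < G" "G \<le> 1" using \<delta> c by (simp_all add: G_def)
  have "G \<le> \<delta> / c" unfolding G_def by (rule min.cobounded2)
  then have Gc: "G * c \<le> \<delta>" using c by (simp add: pos_le_divide_eq)
  obtain \<Lambda> where \<Lambda>: "\<Lambda> > 0" "\<And>x t g h. x $ k \<ge> \<Lambda> \<Longrightarrow> grad_lap (\<lambda>y. u y t) x g h \<Longrightarrow> norm g \<le> G"
    using gradient_small[OF G(1)] by blast
  have jet: "\<exists>g h \<tau>. grad_lap (\<lambda>y. u y t) x g h \<and> (u x has_real_derivative \<tau>) (at t)
      \<and> norm g \<le> G \<and> \<tau> - h \<le> G \<and> 0 \<le> \<tau> - h" if x: "x $ k \<ge> \<Lambda>" for x t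
  proof -
    obtain g h \<tau> where j: "grad_lap (\<lambda>y. u y t) x g h" "(u x has_real_derivative \<tau>) (at t)"
      "\<tau> - h = norm g powr p"
      using sol[of x t] x \<Lambda>(1) unfolding sol_at_def by auto
    have g: "norm g \<le> G" using \<Lambda>(2)[OF x j(1)] .
    have "norm g powr p \<le> G powr p" using g p by (intro powr_mono2) auto
    also have "\<dots> \<le> G powr 1" using G p by (intro powr_mono') auto
    finally have "norm g powr p \<le> G" using G by simp
    then show ?thesis using j g by (metis powr_ge_zero)
  qed
  show ?thesis
  proof
    \<comment> \<open>The additional 2 keeps the ball of radius 2 used for the time increment inside
      the region of small gradient.\<close>
    show "\<Lambda> + 2 > 0" using \<Lambda>(1) by simp
    fix x t assume x: "x $ k \<ge> \<Lambda> + 2"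
    have near: "y $ k \<ge> \<Lambda>" if "norm (y - x) \<le> 2" for y
      using component_le_norm_cart[of "y - x" k] that x by simp
    have cont': "continuous_on (cball x 2 \<times> {t..t + \<sigma>}) (\<lambda>(y, s). u y s)"
      by (rule continuous_on_subset[OF cont])
        (use near \<Lambda>(1) in \<open>force simp: dist_norm norm_minus_commute\<close>)
    have "convex {y. y $ k \<ge> \<Lambda>}"
      using convex_halfspace_ge[of \<Lambda> "axis k 1 :: real^'n"] by (simp add: inner_axis')
    then have 1: "\<bar>u (x + a) (t + \<sigma>) - u x (t + \<sigma>)\<bar> \<le> G * norm (x + a - x)"
    proof (rule grad_bound_lipschitz)
      fix y assume "y \<in> {y. y $ k \<ge> \<Lambda>}"
      with jet[of y "t + \<sigma>"] show "\<exists>g h. grad_lap (\<lambda>y. u y (t + \<sigma>)) y g h \<and> norm g \<le> G" by blast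
    qed (use x a in auto)
    have 2: "u x (t + \<sigma>) \<le> u x t + G + (2 * real CARD('n) * G + 2 * G) * \<sigma>"
    proof (rule time_increment_bound[OF G(1) \<sigma> _ cont'])
      fix y s assume "norm (y - x) \<le> 2"
      from jet[OF near[OF this], of s] obtain g h \<tau> where
        j: "grad_lap (\<lambda>y. u y s) y g h" "(u y has_real_derivative \<tau>) (at s)" "norm g \<le> G" "\<tau> - h \<le> G" by blast
      moreover have "\<tau> - h < 2 * G" using j(4) G(1) by linarith
      ultimately show "\<exists>g h \<tau>. grad_lap (\<lambda>y. u y s) y g h \<and> (u y has_real_derivative \<tau>) (at s)
        \<and> norm g \<le> G \<and> \<tau> - h < 2 * G" by blast
    qed
    have 3: "- u x (t + \<sigma>) \<le> - u x t + G + (2 * real CARD('n) * G + 2 * G) * \<sigma>"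
    proof (rule time_increment_bound[OF G(1) \<sigma>])
      fix y s assume "norm (y - x) \<le> 2"
      from jet[OF near[OF this], of s] obtain g h \<tau> where
        j: "grad_lap (\<lambda>y. u y s) y g h" "(u y has_real_derivative \<tau>) (at s)" "norm g \<le> G" "0 \<le> \<tau> - h" by blast
      have "grad_lap (\<lambda>y. - u y s) y (- g) (- h)" using grad_lap_cmult[OF j(1), of "-1"] by simp
      then show "\<exists>g h \<tau>. grad_lap (\<lambda>y. - u y s) y g h \<and> ((\<lambda>s. - u y s) has_real_derivative \<tau>) (at s)
        \<and> norm g \<le> G \<and> \<tau> - h < 2 * G"
        using DERIV_minus[OF j(2)] j(3,4) G(1) by (intro exI[of _ "- g"] exI[of _ "- h"] exI[of _ "- \<tau>"]) auto
    next
      show "continuous_on (cball x 2 \<times> {t..t + \<sigma>}) (\<lambda>(y, s). - u y s)"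
        using continuous_on_minus[OF cont'] by (simp add: case_prod_unfold)
    qed
    have "\<bar>u (x + a) (t + \<sigma>) - u x t\<bar> \<le> G * norm a + (G + (2 * real CARD('n) * G + 2 * G) * \<sigma>)"
      using 1 2 3 by (simp add: abs_le_iff)
    also have "\<dots> = G * c" by (simp add: c_def algebra_simps)
    finally show "\<bar>u (x + a) (t + \<sigma>) - u x t\<bar> \<le> \<delta>" using Gc by linarith
  qed
qed

lemma translation_invariant:
  assumes a: "a $ k = 0" and \<sigma>: "\<sigma> \<ge> 0" and x0: "x0 $ k > 0"
  shows "u (x0 + a) (t0 + \<sigma>) = u x0 t0"
proof -
  \<comment> \<open>The sign \<zeta> = 1 or -1 yields both one-sided bounds from a single
    comparison, since the differential inequality involves only the norm of the gradient of the
    difference.\<close>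
  have main: "\<zeta> * (u (x0 + a) (t0 + \<sigma>) - u x0 t0) \<le> 2 * \<delta>" if \<delta>: "\<delta> > 0" and \<zeta>: "\<bar>\<zeta>\<bar> = 1" for \<zeta> \<delta> :: real
  proof -
    define z where "z = (\<lambda>x t. \<zeta> * (u (x + a) (t + \<sigma>) - u x t))"
    have z_abs: "\<bar>z x t\<bar> = \<bar>u (x + a) (t + \<sigma>) - u x t\<bar>" for x t by (simp add: z_def abs_mult \<zeta>)
    \<comment> \<open>Chosen so that
      \<open>2 * growth_const * \<epsilon> powr \<alpha> \<le> \<delta>\<close>: on the lower edge
      the difference is at most \<delta>, and the point \<open>x0\<close> stays above that
      edge.\<close>
    define \<epsilon> where "\<epsilon> = min (x0 $ k / 2) ((\<delta> / (2 * growth_const + 1)) powr (1 / \<alpha>))"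
    have gc: "growth_const \<ge> 0" by (rule growth_const_nonneg)
    have \<epsilon>: "0 < \<epsilon>" "\<epsilon> < x0 $ k" "\<epsilon> \<le> (\<delta> / (2 * growth_const + 1)) powr (1 / \<alpha>)"
      using x0 \<delta> gc min.cobounded2[of "x0 $ k / 2" "(\<delta> / (2 * growth_const + 1)) powr (1 / \<alpha>)"]
      unfolding \<epsilon>_def by auto
    have z_growth: "\<bar>z x t\<bar> \<le> 2 * growth_const * (x $ k) powr \<alpha>" if "x $ k > 0" for x t
      using abs_le_growth[OF that, of t] abs_le_growth[of "x + a" "t + \<sigma>"] that a unfolding z_abs by simp
    obtain \<Lambda>0 where \<Lambda>0: "\<Lambda>0 > 0" "\<And>x t. x $ k \<ge> \<Lambda>0 \<Longrightarrow> \<bar>u (x + a) (t + \<sigma>) - u x t\<bar> \<le> \<delta>"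
      using increment_small[OF a \<sigma> \<delta>] by blast
    define \<Lambda> where "\<Lambda> = max \<Lambda>0 (x0 $ k)"
    obtain M where M: "M \<ge> 0" "\<And>x t g h. x $ k \<ge> \<epsilon> \<Longrightarrow> grad_lap (\<lambda>y. u y t) x g h \<Longrightarrow> norm g \<le> M"
      using gradient_bounded_above[OF \<epsilon>(1)] by blast
    have "z x0 t0 \<le> 2 * \<delta>"
    proof (rule strip_maximum_principle[where z=z and ?x0.0=x0 and ?t0.0=t0 and \<delta>=\<delta> and \<epsilon>=\<epsilon> and \<Lambda>=\<Lambda> and k=k and N="p * M powr (p - 1)"
          and B="2 * growth_const * \<Lambda> powr \<alpha>"])
      show "continuous_on ({x. \<epsilon> \<le> x $ k \<and> x $ k \<le> \<Lambda>} \<times> UNIV) (\<lambda>(x, t). z x t)" (is "continuous_on ?T _")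
      proof -
        have "continuous_on ?T (\<lambda>(x, t). \<zeta> * u (a + 1 *\<^sub>R x) (\<sigma> + 1 * t))"
          by (rule continuous_on_rescale[OF cont]) (use \<epsilon> a in auto)
        moreover have "continuous_on ?T (\<lambda>(x, t). \<zeta> * u (0 + 1 *\<^sub>R x) (0 + 1 * t))"
          by (rule continuous_on_rescale[OF cont]) (use \<epsilon> in auto)
        ultimately show ?thesis
          by (auto simp: z_def case_prod_unfold add.commute right_diff_distrib intro!: continuous_on_diff)
      qed
    next
      fix x t
      assume "x \<in> {x. \<epsilon> \<le> x $ k \<and> x $ k \<le> \<Lambda>}"
      then have x: "\<epsilon> \<le> x $ k" "x $ k \<le> \<Lambda>" by auto
      have "z x t \<le> 2 * growth_const * (x $ k) powr \<alpha>" using z_growth[of x t] x \<epsilon> by simp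
      also have "\<dots> \<le> 2 * growth_const * \<Lambda> powr \<alpha>"
        using x \<epsilon> gc p by (intro mult_left_mono powr_mono2) auto
      finally show "z x t \<le> 2 * growth_const * \<Lambda> powr \<alpha>" .
    next
      fix x t
      assume "x $ k = \<epsilon> \<or> x $ k = \<Lambda>"
      then show "z x t \<le> \<delta>"
      proof
        assume e: "x $ k = \<epsilon>"
        have "\<epsilon> powr \<alpha> \<le> ((\<delta> / (2 * growth_const + 1)) powr (1 / \<alpha>)) powr \<alpha>"
          using \<epsilon> p by (intro powr_mono2) auto
        also have "\<dots> = \<delta> / (2 * growth_const + 1)" using p \<delta> gc by (simp add: powr_powr)
        finally have "2 * growth_const * \<epsilon> powr \<alpha> \<le> 2 * growth_const * (\<delta> / (2 * growth_const + 1))"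
          using gc by (intro mult_left_mono) auto
        also have "\<dots> \<le> \<delta>" using gc \<delta> by (simp add: field_simps)
        finally show ?thesis using z_growth[of x t] e \<epsilon> by simp
      next
        assume "x $ k = \<Lambda>"
        then show ?thesis using \<Lambda>0(2)[of x t] z_abs[of x t] by (simp add: \<Lambda>_def)
      qed
    next
      fix x t
      assume x: "\<epsilon> < x $ k" "x $ k < \<Lambda>"
      obtain g1 h1 \<tau>1 where 1: "grad_lap (\<lambda>y. u y (t + \<sigma>)) (x + a) g1 h1"
        "(u (x + a) has_real_derivative \<tau>1) (at (t + \<sigma>))" "\<tau>1 - h1 = norm g1 powr p"
        using sol[of "x + a" "t + \<sigma>"] x \<epsilon> a unfolding sol_at_def by auto
      obtain g2 h2 \<tau>2 where 2: "grad_lap (\<lambda>y. u y t) x g2 h2"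
        "(u x has_real_derivative \<tau>2) (at t)" "\<tau>2 - h2 = norm g2 powr p"
        using sol[of x t] x \<epsilon> unfolding sol_at_def by auto
      have "grad_lap (\<lambda>y. u y (t + \<sigma>)) (a + 1 *\<^sub>R x) g1 h1" using 1(1) by (simp add: add.commute)
      from grad_lap_cmult[OF grad_lap_diff[OF grad_lap_affine[OF this] 2(1)], of \<zeta>]
      have gl: "grad_lap (\<lambda>y. z y t) x (\<zeta> *\<^sub>R (g1 - g2)) (\<zeta> * (h1 - h2))"
        by (simp add: z_def add.commute)
      have td: "(z x has_real_derivative \<zeta> * (\<tau>1 - \<tau>2)) (at t)"
        unfolding z_def
        by (intro DERIV_cmult DERIV_diff 2(2) DERIV_shift[THEN iffD1, OF 1(2)])
      have gn: "norm g1 \<le> M" "norm g2 \<le> M" using M(2)[OF _ 1(1)] M(2)[OF _ 2(1)] x a by auto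
      have "\<zeta> * (\<tau>1 - \<tau>2) - \<zeta> * (h1 - h2) = \<zeta> * (norm g1 powr p - norm g2 powr p)"
        unfolding 1(3)[symmetric] 2(3)[symmetric] by (simp add: algebra_simps)
      also have "\<dots> \<le> \<bar>norm g1 powr p - norm g2 powr p\<bar>"
        using abs_ge_self[of "\<zeta> * (norm g1 powr p - norm g2 powr p)"] by (simp add: abs_mult \<zeta>)
      also have "\<dots> \<le> p * M powr (p - 1) * \<bar>norm g1 - norm g2\<bar>"
        using powr_diff_le[of "norm g1" "norm g2" M p] powr_diff_le[of "norm g2" "norm g1" M p] gn p
        by (simp add: abs_le_iff abs_minus_commute)
      also have "\<dots> \<le> p * M powr (p - 1) * norm (\<zeta> *\<^sub>R (g1 - g2))"
        using p norm_triangle_ineq3[of g1 g2] by (intro mult_left_mono) (auto simp: \<zeta>)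
      finally show "\<exists>g h \<tau>. grad_lap (\<lambda>y. z y t) x g h \<and> (z x has_real_derivative \<tau>) (at t)
        \<and> \<tau> - h \<le> p * M powr (p - 1) * norm g" using gl td by blast
    qed (use \<epsilon> p \<delta> x0 in \<open>auto simp: \<Lambda>_def\<close>)
    then show ?thesis by (simp add: z_def)
  qed
  have "\<bar>u (x0 + a) (t0 + \<sigma>) - u x0 t0\<bar> \<le> e" if "e > 0" for e
    using main[of "e / 2" 1] main[of "e / 2" "-1"] that by (simp add: abs_le_iff)
  then have "\<bar>u (x0 + a) (t0 + \<sigma>) - u x0 t0\<bar> \<le> 0" by (rule field_le_epsilon) simp
  then show ?thesis by simp
qed

lemma depends_only_on_height:
  assumes "x $ k \<ge> 0"
  shows "u x t = u (axis k (x $ k)) 0"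
proof (cases "x $ k = 0")
  case True
  then show ?thesis using boundary by (simp add: axis_def)
next
  case False
  then have x: "x $ k > 0" using assms by simp
  \<comment> \<open>Time shifts are available forwards only, so \<open>t\<close> and 0 are both
    compared with the later of the two.\<close>
  have "u x t = u x (max t 0)"
    using translation_invariant[of 0 "max t 0 - t" x t] x by simp
  also have "\<dots> = u x 0"
    using translation_invariant[of 0 "max t 0" x 0] x by simp
  also have "\<dots> = u (axis k (x $ k)) 0"
    using translation_invariant[of "axis k (x $ k) - x" 0 x 0] x by simp
  finally show ?thesis .
qed

end

section \<open>The Liouville theorem\<close>

lemma entire_solution_half_space_solution:
  fixes k :: "'n::finite"
  assumes "p > 2" "entire_solution p k u"
  shows "half_space_solution p k u"
proof -
  have hs: "half_space k = {x :: real^'n. x $ k > 0}" by (simp add: half_space_def)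
  have closure_hs: "closure (half_space k) = {x :: real^'n. x $ k \<ge> 0}"
    using closure_halfspace_component_gt[of 0 k] by (simp add: hs)
  obtain Du D2u ut where raw: "\<forall>x\<in>half_space k. \<forall>t\<in>UNIV.
        ((\<lambda>y. u y t) has_derivative (\<lambda>h. Du x t \<bullet> h)) (at x)
      \<and> (\<forall>i. ((\<lambda>y. Du y t $ i) has_derivative (\<lambda>h. D2u x t $ i \<bullet> h)) (at x))
      \<and> ((\<lambda>s. u x s) has_real_derivative ut x t) (at t)
      \<and> ut x t - (\<Sum>i\<in>UNIV. D2u x t $ i $ i) = norm (Du x t) powr p"
    and cont: "continuous_on (closure (half_space k \<times> UNIV)) (\<lambda>(x, t). u x t)"
    and bd: "\<forall>x t. x $ k = 0 \<longrightarrow> t \<in> closure UNIV \<longrightarrow> u x t = 0"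
    using assms(2) unfolding entire_solution_def is_solution_def by (elim exE conjE) (rule that)
  have *: "((\<lambda>y. u y t) has_derivative (\<lambda>h. Du x t \<bullet> h)) (at x)
      \<and> (\<forall>i. ((\<lambda>y. Du y t $ i) has_derivative (\<lambda>h. D2u x t $ i \<bullet> h)) (at x))
      \<and> ((\<lambda>s. u x s) has_real_derivative ut x t) (at t)
      \<and> ut x t - (\<Sum>i\<in>UNIV. D2u x t $ i $ i) = norm (Du x t) powr p" if "x $ k > 0" for x t
    using raw that unfolding hs by blast
  show ?thesis
  proof
    fix x :: "real^'n" and t assume x: "x $ k > 0"
    \<comment> \<open>Openness of the half-space turns the pointwise derivatives into the
      neighbourhood condition that \<open>grad_lap\<close> demands.\<close>
    have "\<forall>\<^sub>F y in nhds x. 0 < y $ k"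
      using eventually_nhds_in_open[OF open_halfspace_component_gt_cart[of 0 k], of x] x by simp
    then have "\<forall>\<^sub>F y in nhds x. ((\<lambda>y. u y t) has_derivative (\<lambda>h. Du y t \<bullet> h)) (at y)"
      by eventually_elim (use * in blast)
    then have "grad_lap (\<lambda>y. u y t) x (Du x t) (\<Sum>i\<in>UNIV. D2u x t $ i $ i)"
      by (rule grad_lapI[where D="\<lambda>y. Du y t" and H="\<lambda>i. D2u x t $ i"]) (use *[OF x] in auto)
    then show "sol_at p u x t" unfolding sol_at_def using *[OF x] by blast
  next
    show "continuous_on ({x. 0 \<le> x $ k} \<times> UNIV) (\<lambda>(x, t). u x t)"
      using cont by (simp add: closure_Times closure_hs)
  qed (use assms(1) bd in auto)
qed

theorem theorem2p3:
  fixes p :: real and k :: "'n::finite" and u :: "real^'n \<Rightarrow> real \<Rightarrow> real"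
  assumes "p > 2"
    and "entire_solution p k u"
  shows "\<exists>g :: real \<Rightarrow> real. \<forall>x t. x $ k \<ge> 0 \<longrightarrow> u x t = g (x $ k)"
proof -
  interpret half_space_solution p k u
    using assms by (rule entire_solution_half_space_solution)
  show ?thesis
    using depends_only_on_height by (intro exI[of _ "\<lambda>r. u (axis k r) 0"]) blast
qed

end
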